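(* Let $\Psi$ be a quantum operation with respect to a Hilbert space $\mathcal{H}$. (a) We always have $\mathcal{C}^\Psi_2=\mathcal{C}^\Psi_{\mathrm{p}}=\mathcal{C}^\Psi_{\mathrm{c}}=\mathcal{C}^\Psi_{\mathrm{w}}$ and this set is a von Neumann algebra. (b) The following assertions are equivalent: (i) $\mathcal{C}^\Psi$ is stable under multiplication. (ii) $\mathcal{C}^\Psi=\mathcal{C}^\Psi_2$. (iii) $\mathcal{C}^\Psi$ is a $C^*$-algebra. (iv) $\mathcal{C}^\Psi$ is a von Neumann algebra.
   Context: $\mathcal{B}(\mathcal{H})$ is the algebra of bounded operators on $\mathcal{H}$, $\mathcal{B}_1(\mathcal{H})$ the trace class, and $\mathcal{D}(\mathcal{H})$ the set of states, i.e. positive $\rho\in\mathcal{B}_1(\mathcal{H})$ with $\operatorname{tr}(\rho)=1$. A quantum operation is a completely positive, trace-preserving linear map $\Psi\colon\mathcal{B}_1(\mathcal{H})\to\mathcal{B}_1(\mathcal{H})$. Its set of constants is $\mathcal{C}^\Psi=\{A\in\mathcal{B}(\mathcal{H})\mid\operatorname{tr}(\Psi(\rho)A)=\operatorname{tr}(\rho A)\text{ for all }\rho\in\mathcal{D}(\mathcal{H})\}$; equivalently, $\mathcal{C}^\Psi$ is the set of fixed points of the dual map $\Psi^\sharp\colon\mathcal{B}(\mathcal{H})\to\mathcal{B}(\mathcal{H})$, $\operatorname{tr}(\Psi(T)S)=\operatorname{tr}(T\Psi^\sharp(S))$. Further: $\mathcal{C}^\Psi_2=\{A\in\mathcal{B}(\mathcal{H})\mid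 A,A^*A,AA^*\in\mathcal{C}^\Psi\}$; $\mathcal{C}^\Psi_{\mathrm{p}}=\{A\in\mathcal{B}(\mathcal{H})\mid p(A,A^* )\in\mathcal{C}^\Psi\text{ for all complex polynomials }p\text{ in two noncommutative variables}\}$; $\mathcal{C}^\Psi_{\mathrm{c}}=\{A\in\mathcal{B}(\mathcal{H})\mid C^*(I,A)\subseteq\mathcal{C}^\Psi\}$, where $C^*(I,A)$ is the $C^*$-algebra generated by $I$ and $A$; $\mathcal{C}^\Psi_{\mathrm{w}}=\{A\in\mathcal{B}(\mathcal{H})\mid W^*(A)\subseteq\mathcal{C}^\Psi\}$, where $W^*(A)$ is the von Neumann algebra generated by $A$. *)

theory Defs
  imports "HOL-Analysis.Analysis" "HOL-Library.Poly_Mapping"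
begin

section \<open>Complex Hilbert spaces\<close>

text \<open>The inner product is conjugate-linear in the first argument. Additivity and
  conjugate-linearity in the first argument, and \<open>1 *\<^sub>C x = x\<close>, follow from the
  axioms below; definiteness follows from \<open>norm_eq_sqrt_cinner\<close>.\<close>

class chilbert = banach +
  fixes scaleC :: "complex \<Rightarrow> 'a \<Rightarrow> 'a" (infixr \<open>*\<^sub>C\<close> 75)
    and cinner :: "'a \<Rightarrow> 'a \<Rightarrow> complex"
  assumes scaleR_scaleC: "r *\<^sub>R x = complex_of_real r *\<^sub>C x"
    and scaleC_add_right: "c *\<^sub>C (x + y) = c *\<^sub>C x + c *\<^sub>C y"
    and scaleC_add_left: "(c + d) *\<^sub>C x = c *\<^sub>C x + d *\<^sub>C x"
    and scaleC_scaleC: "c *\<^sub>C d *\<^sub>C x = (c * d) *\<^sub>C x"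
    and cinner_commute: "cinner x y = cnj (cinner y x)"
    and cinner_add_right: "cinner x (y + z) = cinner x y + cinner x z"
    and cinner_scaleC_right: "cinner x (c *\<^sub>C y) = c * cinner x y"
    and norm_eq_sqrt_cinner: "norm x = sqrt (Re (cinner x x))"

lemma norm_scaleC: "norm (c *\<^sub>C x) = cmod c * norm (x :: 'a::chilbert)"
proof -
  have "cinner (c *\<^sub>C x) (c *\<^sub>C x) = c * cnj (c * cinner x x)"
    by (metis cinner_commute cinner_scaleC_right)
  also have "\<dots> = complex_of_real ((cmod c)\<^sup>2) * cinner x x"
    by (metis cinner_commute complex_cnj_mult complex_norm_square mult.assoc)
  finally show ?thesis
    by (simp add: norm_eq_sqrt_cinner real_sqrt_mult)
qed

lemma bounded_linear_scaleC: "bounded_linear (\<lambda>x :: 'a::chilbert. c *\<^sub>C x)"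
proof (rule bounded_linear_intro)
  show "c *\<^sub>C (r *\<^sub>R x) = r *\<^sub>R (c *\<^sub>C x)" for r and x :: 'a
    by (simp add: scaleR_scaleC scaleC_scaleC mult.commute)
  show "norm (c *\<^sub>C x) \<le> norm x * cmod c" for x :: 'a
    by (simp add: norm_scaleC mult.commute)
qed (rule scaleC_add_right)

definition orthonormal_basis :: "'a::chilbert set \<Rightarrow> bool" where
  "orthonormal_basis E \<longleftrightarrow>
     (\<forall>e\<in>E. norm e = 1) \<and> (\<forall>e\<in>E. \<forall>f\<in>E. e \<noteq> f \<longrightarrow> cinner e f = 0) \<and>
     (\<forall>x. (\<forall>e\<in>E. cinner e x = 0) \<longrightarrow> x = 0)"


section \<open>Bounded operators, trace class, states\<close>

text \<open>\<^typ>\<open>'a \<Rightarrow>\<^sub>L 'a\<close> is the library's type of bounded \<^emph>\<open>real\<close>-linear operators with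
  the operator norm; \<open>\<B>(\<H>)\<close> consists of its complex-linear elements.\<close>

definition bounded_ops :: "('a::chilbert \<Rightarrow>\<^sub>L 'a) set" where
  "bounded_ops = {A. \<forall>c x. blinfun_apply A (c *\<^sub>C x) = c *\<^sub>C blinfun_apply A x}"

lift_definition scale_op :: "complex \<Rightarrow> ('a::chilbert \<Rightarrow>\<^sub>L 'a) \<Rightarrow> ('a \<Rightarrow>\<^sub>L 'a)"
  is "\<lambda>c A x. c *\<^sub>C A x"
  by (rule bounded_linear_compose[OF bounded_linear_scaleC])

definition adj :: "('a::chilbert \<Rightarrow>\<^sub>L 'a) \<Rightarrow> ('a \<Rightarrow>\<^sub>L 'a)" where
  "adj A = (THE B. B \<in> bounded_ops \<and>
      (\<forall>x y. cinner (blinfun_apply B x) y = cinner x (blinfun_apply A y)))"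

definition positive_op :: "('a::chilbert \<Rightarrow>\<^sub>L 'a) \<Rightarrow> bool" where
  "positive_op A \<longleftrightarrow> A \<in> bounded_ops \<and> (\<forall>x. cinner x (blinfun_apply A x) \<in> \<real>\<^sub>\<ge>\<^sub>0)"

text \<open>\<open>|A| = (A\<^sup>* A)\<^sup>1\<^sup>/\<^sup>2\<close>, the unique positive square root.\<close>

definition abs_op :: "('a::chilbert \<Rightarrow>\<^sub>L 'a) \<Rightarrow> ('a \<Rightarrow>\<^sub>L 'a)" where
  "abs_op A = (THE P. positive_op P \<and> P o\<^sub>L P = adj A o\<^sub>L A)"

definition trace_class :: "('a::chilbert \<Rightarrow>\<^sub>L 'a) set" where
  "trace_class = {T \<in> bounded_ops. \<exists>E. orthonormal_basis E \<and>
      (\<lambda>e. cinner e (blinfun_apply (abs_op T) e)) summable_on E}"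

text \<open>For trace class operators the choice of the orthonormal basis is immaterial.\<close>

definition trace_op :: "('a::chilbert \<Rightarrow>\<^sub>L 'a) \<Rightarrow> complex" where
  "trace_op T = (\<Sum>\<^sub>\<infinity>e\<in>(SOME E. orthonormal_basis E). cinner e (blinfun_apply T e))"

definition states :: "('a::chilbert \<Rightarrow>\<^sub>L 'a) set" where
  "states = {\<rho> \<in> trace_class. positive_op \<rho> \<and> trace_op \<rho> = 1}"


section \<open>Quantum operations\<close>

text \<open>An \<open>n \<times> n\<close> operator matrix \<open>[T\<^sub>i\<^sub>j]\<close> acts on \<open>\<H>\<^sup>n\<close> by
  \<open>(T x)\<^sub>i = \<Sum>\<^sub>j T\<^sub>i\<^sub>j x\<^sub>j\<close>; indices range over \<open>{..<n}\<close> and only the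
  values of \<open>T\<close> and \<open>x\<close> at such indices matter.\<close>

definition positive_matrix :: "nat \<Rightarrow> (nat \<Rightarrow> nat \<Rightarrow> ('a::chilbert \<Rightarrow>\<^sub>L 'a)) \<Rightarrow> bool" where
  "positive_matrix n T \<longleftrightarrow> (\<forall>i<n. \<forall>j<n. T i j \<in> bounded_ops) \<and>
     (\<forall>x :: nat \<Rightarrow> 'a. (\<Sum>i<n. cinner (x i) (\<Sum>j<n. blinfun_apply (T i j) (x j))) \<in> \<real>\<^sub>\<ge>\<^sub>0)"

text \<open>Maps \<open>\<B>\<^sub>1(\<H>) \<rightarrow> \<B>\<^sub>1(\<H>)\<close> are represented by functions on the whole type
  \<^typ>\<open>'a \<Rightarrow>\<^sub>L 'a\<close> whose values outside \<open>trace_class\<close> are irrelevant.\<close>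

definition completely_positive :: "(('a::chilbert \<Rightarrow>\<^sub>L 'a) \<Rightarrow> ('a \<Rightarrow>\<^sub>L 'a)) \<Rightarrow> bool" where
  "completely_positive \<Psi> \<longleftrightarrow>
     (\<forall>n T. (\<forall>i<n. \<forall>j<n. T i j \<in> trace_class) \<longrightarrow> positive_matrix n T \<longrightarrow>
        positive_matrix n (\<lambda>i j. \<Psi> (T i j)))"

definition quantum_operation :: "(('a::chilbert \<Rightarrow>\<^sub>L 'a) \<Rightarrow> ('a \<Rightarrow>\<^sub>L 'a)) \<Rightarrow> bool" where
  "quantum_operation \<Psi> \<longleftrightarrow>
     (\<forall>T\<in>trace_class. \<Psi> T \<in> trace_class) \<and>
     (\<forall>S\<in>trace_class. \<forall>T\<in>trace_class. \<Psi> (S + T) = \<Psi> S + \<Psi> T) \<and>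
     (\<forall>c. \<forall>T\<in>trace_class. \<Psi> (scale_op c T) = scale_op c (\<Psi> T)) \<and>
     completely_positive \<Psi> \<and>
     (\<forall>T\<in>trace_class. trace_op (\<Psi> T) = trace_op T)"


section \<open>Operator algebras\<close>

definition star_subalgebra :: "('a::chilbert \<Rightarrow>\<^sub>L 'a) set \<Rightarrow> bool" where
  "star_subalgebra M \<longleftrightarrow> M \<subseteq> bounded_ops \<and> 0 \<in> M \<and>
     (\<forall>A\<in>M. \<forall>B\<in>M. A + B \<in> M) \<and> (\<forall>c. \<forall>A\<in>M. scale_op c A \<in> M) \<and>
     (\<forall>A\<in>M. \<forall>B\<in>M. A o\<^sub>L B \<in> M) \<and> (\<forall>A\<in>M. adj A \<in> M)"

text \<open>\<open>closed\<close> refers to the operator norm.\<close>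

definition cstar_algebra :: "('a::chilbert \<Rightarrow>\<^sub>L 'a) set \<Rightarrow> bool" where
  "cstar_algebra M \<longleftrightarrow> star_subalgebra M \<and> closed M"

text \<open>The weak operator topology on \<open>\<B>(\<H>)\<close>: the coarsest topology making all
  \<open>A \<mapsto> \<langle>x, A y\<rangle>\<close> continuous, i.e.\ the pullback of the product topology, which
  is what \<open>euclidean\<close> means on a function type.\<close>

definition weak_operator_topology :: "('a::chilbert \<Rightarrow>\<^sub>L 'a) topology" where
  "weak_operator_topology =
     pullback_topology bounded_ops (\<lambda>A. \<lambda>(x, y). cinner x (blinfun_apply A y))
       (euclidean :: ('a \<times> 'a \<Rightarrow> complex) topology)"

definition von_neumann_algebra :: "('a::chilbert \<Rightarrow>\<^sub>L 'a) set \<Rightarrow> bool" where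
  "von_neumann_algebra M \<longleftrightarrow>
     star_subalgebra M \<and> id_blinfun \<in> M \<and> closedin weak_operator_topology M"

definition cstar_generated :: "('a::chilbert \<Rightarrow>\<^sub>L 'a) set \<Rightarrow> ('a \<Rightarrow>\<^sub>L 'a) set" where
  "cstar_generated S = \<Inter>{M. cstar_algebra M \<and> S \<subseteq> M}"

definition vn_generated :: "('a::chilbert \<Rightarrow>\<^sub>L 'a) set \<Rightarrow> ('a \<Rightarrow>\<^sub>L 'a) set" where
  "vn_generated S = \<Inter>{M. von_neumann_algebra M \<and> S \<subseteq> M}"


section \<open>Polynomials in two noncommutative variables\<close>

text \<open>A polynomial is a finitely supported family of complex coefficients indexed by
  the words (including the empty one) in the two letters.\<close>

datatype nc_var = VarX | VarY

type_synonym nc_poly = "nc_var list \<Rightarrow>\<^sub>0 complex"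

fun eval_word :: "('a::chilbert \<Rightarrow>\<^sub>L 'a) \<Rightarrow> ('a \<Rightarrow>\<^sub>L 'a) \<Rightarrow> nc_var list \<Rightarrow> ('a \<Rightarrow>\<^sub>L 'a)" where
  "eval_word A B [] = id_blinfun"
| "eval_word A B (VarX # w) = A o\<^sub>L eval_word A B w"
| "eval_word A B (VarY # w) = B o\<^sub>L eval_word A B w"

definition eval_poly :: "nc_poly \<Rightarrow> ('a::chilbert \<Rightarrow>\<^sub>L 'a) \<Rightarrow> ('a \<Rightarrow>\<^sub>L 'a) \<Rightarrow> ('a \<Rightarrow>\<^sub>L 'a)" where
  "eval_poly p A B =
     (\<Sum>w\<in>Poly_Mapping.keys p. scale_op (Poly_Mapping.lookup p w) (eval_word A B w))"


section \<open>Constants of a quantum operation\<close>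

definition constants :: "(('a::chilbert \<Rightarrow>\<^sub>L 'a) \<Rightarrow> ('a \<Rightarrow>\<^sub>L 'a)) \<Rightarrow> ('a \<Rightarrow>\<^sub>L 'a) set" where
  "constants \<Psi> =
     {A \<in> bounded_ops. \<forall>\<rho>\<in>states. trace_op (\<Psi> \<rho> o\<^sub>L A) = trace_op (\<rho> o\<^sub>L A)}"

definition constants2 :: "(('a::chilbert \<Rightarrow>\<^sub>L 'a) \<Rightarrow> ('a \<Rightarrow>\<^sub>L 'a)) \<Rightarrow> ('a \<Rightarrow>\<^sub>L 'a) set" where
  "constants2 \<Psi> = {A \<in> bounded_ops.
     A \<in> constants \<Psi> \<and> adj A o\<^sub>L A \<in> constants \<Psi> \<and> A o\<^sub>L adj A \<in> constants \<Psi>}"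

definition constants_p :: "(('a::chilbert \<Rightarrow>\<^sub>L 'a) \<Rightarrow> ('a \<Rightarrow>\<^sub>L 'a)) \<Rightarrow> ('a \<Rightarrow>\<^sub>L 'a) set" where
  "constants_p \<Psi> = {A \<in> bounded_ops. \<forall>p. eval_poly p A (adj A) \<in> constants \<Psi>}"

definition constants_c :: "(('a::chilbert \<Rightarrow>\<^sub>L 'a) \<Rightarrow> ('a \<Rightarrow>\<^sub>L 'a)) \<Rightarrow> ('a \<Rightarrow>\<^sub>L 'a) set" where
  "constants_c \<Psi> = {A \<in> bounded_ops. cstar_generated {id_blinfun, A} \<subseteq> constants \<Psi>}"

definition constants_w :: "(('a::chilbert \<Rightarrow>\<^sub>L 'a) \<Rightarrow> ('a \<Rightarrow>\<^sub>L 'a)) \<Rightarrow> ('a \<Rightarrow>\<^sub>L 'a) set" where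
  "constants_w \<Psi> = {A \<in> bounded_ops. vn_generated {A} \<subseteq> constants \<Psi>}"

end

theory Submission
  imports Defs
begin

text \<open>Write \<open>|x\<rangle>\<langle>y|\<close> for the operator \<open>z \<mapsto> \<langle>y, z\<rangle> x\<close> and \<open>W x y = \<Psi>(|x\<rangle>\<langle>y|)\<close>. If \<open>\<Psi>\<close> is given in Kraus
  form by operators \<open>V\<^sub>i\<close>, the set \<open>constants2 \<Psi>\<close> is the commutant of all \<open>V\<^sub>i\<close> and \<open>V\<^sub>i\<^sup>*\<close>: for
  \<open>A \<in> constants2 \<Psi>\<close> the operator \<open>\<Sum>\<^sub>i [A, V\<^sub>i]\<^sup>* [A, V\<^sub>i]\<close> expands into terms that cancel. The proof
  carries this argument out with the operators \<open>W x y\<close> in place of a Kraus or Stinespring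
  representation. The commutant becomes the set of \<open>intertwiners\<close>, the bounded \<open>A\<close> with
  \<open>A (W x y) = W (A x) y\<close> and \<open>A\<^sup>* (W x y) = W (A\<^sup>* x) y\<close> for all vectors \<open>x\<close>, \<open>y\<close>.

  The intertwiners evidently form a unital star-algebra. They are weakly closed
  (\<open>intertwiners_closedin\<close>), because complete positivity makes \<open>z \<mapsto> \<langle>u, W z y v\<rangle>\<close> a bounded functional
  of \<open>z\<close>, so that both sides of the defining relations are weakly continuous in \<open>A\<close>. They are
  constants, since \<open>(W x y) A = W x (A\<^sup>* y)\<close> and \<open>\<Psi>\<close> preserves the trace. Conversely, if \<open>A\<close> and
  \<open>A\<^sup>*A\<close> are constants, the trace of a sum of nonnegative forms vanishes, so that each of them
  vanishes, and the null vectors of the form given by complete positivity yield the intertwining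
  relation (\<open>constants_intertwine\<close>). Hence \<open>constants2 \<Psi>\<close> is the von Neumann algebra of
  intertwiners, and everything else is formal: an operator in a von Neumann algebra of constants
  generates algebras of constants, and constants are stable under adjoints.

  Two tools support this. First, a condition on all states has to be reduced to pure states
  (\<open>constantsI\<close>); finite-rank truncations of a state leave a positive remainder whose small trace \<open>\<Psi>\<close>
  preserves. Second, the traces of products that occur must be summable, independent of the basis
  and cyclic. For a positive trace class operator \<open>P = R\<^sup>2\<close> this follows from the symmetry
  \<open>\<Sum>\<^sub>e \<parallel>X e\<parallel>\<^sup>2 = \<Sum>\<^sub>f \<parallel>X\<^sup>* f\<parallel>\<^sup>2\<close> of the Hilbert--Schmidt norm (\<open>has_sum_norm_squared_adj\<close>), and polarization
  extends it to all \<open>W x y\<close>. Existence and uniqueness of positive square roots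
  (\<open>positive_sqrt_exists\<close>, \<open>positive_sqrt_unique\<close>) and the representation theorem of Riesz are proved on
  the way.\<close>

section \<open>Geometry of complex Hilbert spaces\<close>

lemma scaleC_one [simp]: "1 *\<^sub>C x = (x :: 'a::chilbert)"
  using scaleR_scaleC[of 1 x] by simp

lemma scaleC_zero_left [simp]: "0 *\<^sub>C x = (0 :: 'a::chilbert)"
  using scaleR_scaleC[of 0 x] by simp

lemma scaleC_zero_right [simp]: "c *\<^sub>C 0 = (0 :: 'a::chilbert)"
  by (rule linear_simps(3)[OF bounded_linear_scaleC])

lemma scaleC_diff_right: "c *\<^sub>C (x - y) = c *\<^sub>C x - c *\<^sub>C (y :: 'a::chilbert)"
  by (rule linear_simps(2)[OF bounded_linear_scaleC])

lemma scaleC_minus_one: "(- 1) *\<^sub>C x = - (x :: 'a::chilbert)"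
  using scaleR_scaleC[of "-1" x] by simp

lemma cinner_add_left: "cinner (x + y) (z :: 'a::chilbert) = cinner x z + cinner y z"
  by (metis cinner_commute cinner_add_right complex_cnj_add)

lemma cinner_scaleC_left: "cinner (c *\<^sub>C x) (y :: 'a::chilbert) = cnj c * cinner x y"
  by (metis cinner_commute cinner_scaleC_right complex_cnj_mult)

lemma cinner_zero_right [simp]: "cinner x (0 :: 'a::chilbert) = 0"
  using cinner_scaleC_right[of x 0 0] by simp

lemma cinner_zero_left [simp]: "cinner (0 :: 'a::chilbert) x = 0"
  using cinner_scaleC_left[of 0 0 x] by simp

lemma cinner_minus_right [simp]: "cinner x (- y :: 'a::chilbert) = - cinner x y"
  using cinner_add_right[of x y "-y"] by (simp add: add_eq_0_iff)

lemma cinner_minus_left [simp]: "cinner (- x :: 'a::chilbert) y = - cinner x y"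
  using cinner_add_left[of x "-x" y] by (simp add: add_eq_0_iff)

lemma cinner_diff_right: "cinner x (y - z :: 'a::chilbert) = cinner x y - cinner x z"
  using cinner_add_right[of x y "-z"] by simp

lemma cinner_diff_left: "cinner (x - y :: 'a::chilbert) z = cinner x z - cinner y z"
  using cinner_add_left[of x "-y" z] by simp

lemma cinner_sum_right: "cinner x (sum f F :: 'a::chilbert) = (\<Sum>i\<in>F. cinner x (f i))"
  by (induction F rule: infinite_finite_induct) (simp_all add: cinner_add_right)

lemma cinner_sum_left: "cinner (sum f F :: 'a::chilbert) x = (\<Sum>i\<in>F. cinner (f i) x)"
  by (induction F rule: infinite_finite_induct) (simp_all add: cinner_add_left)

lemma cinner_self: "cinner x x = complex_of_real ((norm (x :: 'a::chilbert))\<^sup>2)"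
proof -
  have "Im (cinner x x) = 0"
    using arg_cong[OF cinner_commute[of x x], of Im] by simp
  moreover have "Re (cinner x x) = (norm x)\<^sup>2"
    using norm_eq_sqrt_cinner[of x] norm_ge_zero[of x] by simp
  ultimately show ?thesis
    by (simp add: complex_eq_iff)
qed

lemma cinner_eq_zero_imp: 
  assumes "\<And>y. cinner y (x :: 'a::chilbert) = 0"
  shows "x = 0"
  using assms[of x] by (simp add: cinner_self)

lemma cinner_eqI:
  assumes "\<And>z. cinner z x = cinner z (y :: 'a::chilbert)"
  shows "x = y"
  using cinner_eq_zero_imp[of "x - y"] assms by (simp add: cinner_diff_right)

lemma norm_add_squared:
  "(norm (x + y :: 'a::chilbert))\<^sup>2 = (norm x)\<^sup>2 + 2 * Re (cinner x y) + (norm y)\<^sup>2"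
proof -
  have "Re (cinner (x + y) (x + y)) = (norm x)\<^sup>2 + 2 * Re (cinner x y) + (norm y)\<^sup>2"
    using arg_cong[OF cinner_commute[of x y], of Re]
    by (simp only: cinner_add_left cinner_add_right) (simp add: cinner_self)
  then show ?thesis
    by (simp only: cinner_self Re_complex_of_real)
qed

lemma norm_add_squared_orthogonal:
  "cinner x y = 0 \<Longrightarrow> (norm (x + y :: 'a::chilbert))\<^sup>2 = (norm x)\<^sup>2 + (norm y)\<^sup>2"
  by (simp add: norm_add_squared)

lemma cnj_mult_self: "cnj z * z = complex_of_real ((cmod z)\<^sup>2)"
  using complex_norm_square[of z] by (simp only: mult.commute)

text \<open>Every Cauchy--Schwarz inequality below is an instance of this statement about the quadratic
  form \<open>c \<mapsto> a + 2 Re (c b) + d |c|\<^sup>2\<close>: the phase and size of \<open>c\<close> are chosen to make its value as small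
  as possible. For \<open>a = 0\<close> it says that a null vector is orthogonal to everything.\<close>

lemma quadratic_form_discriminant:
  fixes a d :: real and b :: complex
  assumes nonneg: "\<And>c. 0 \<le> a + 2 * Re (c * b) + (cmod c)\<^sup>2 * d" and d: "d \<ge> 0"
  shows "(cmod b)\<^sup>2 \<le> a * d"
proof -
  have s: "0 \<le> a - 2 * s * (cmod b)\<^sup>2 + s\<^sup>2 * (cmod b)\<^sup>2 * d" for s :: real
  proof -
    have "Re ((complex_of_real (- s) * cnj b) * b) = - s * (cmod b)\<^sup>2"
      by (simp only: mult.assoc cnj_mult_self Re_complex_of_real flip: of_real_mult)
    moreover have "(cmod (complex_of_real (- s) * cnj b))\<^sup>2 = s\<^sup>2 * (cmod b)\<^sup>2"
      by (simp add: norm_mult power_mult_distrib)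
    ultimately show ?thesis
      using nonneg[of "complex_of_real (- s) * cnj b"] by simp
  qed
  show ?thesis
  proof (cases "d = 0")
    case True
    have "b = 0"
    proof (rule ccontr)
      assume "b \<noteq> 0"
      \<comment> \<open>The form is now affine in \<open>s\<close> with negative slope; this \<open>s\<close> makes its value \<open>- 1\<close>.\<close>
      then have "(cmod b)\<^sup>2 > 0" by simp
      then show False
        using s[of "(a + 1) / (2 * (cmod b)\<^sup>2)"] True by (simp add: field_simps)
    qed
    then show ?thesis using True by simp
  next
    case False
    then have "d > 0" using d by simp
    then show ?thesis
      using s[of "1 / d"] by (simp add: field_simps power2_eq_square)
  qed
qed

lemma cinner_Cauchy_Schwarz: "cmod (cinner x y) \<le> norm x * norm (y :: 'a::chilbert)"
proof -
  have "0 \<le> (norm x)\<^sup>2 + 2 * Re (c * cinner x y) + (cmod c)\<^sup>2 * (norm y)\<^sup>2" for c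
    using zero_le_power2[of "norm (x + c *\<^sub>C y)"]
    by (simp add: norm_add_squared cinner_scaleC_right norm_scaleC power_mult_distrib)
  then have "(cmod (cinner x y))\<^sup>2 \<le> (norm x)\<^sup>2 * (norm y)\<^sup>2"
    by (rule quadratic_form_discriminant) simp
  then show ?thesis
    by (metis mult_nonneg_nonneg norm_ge_zero power2_le_imp_le power_mult_distrib)
qed

lemma bounded_bilinear_cinner: "bounded_bilinear (cinner :: 'a::chilbert \<Rightarrow> 'a \<Rightarrow> complex)"
proof
  show "cinner (r *\<^sub>R x) y = r *\<^sub>R cinner x y" for r and x y :: 'a
    by (simp add: scaleR_scaleC cinner_scaleC_left scaleR_conv_of_real)
  show "cinner x (r *\<^sub>R y) = r *\<^sub>R cinner x y" for r and x y :: 'a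
    by (simp add: scaleR_scaleC cinner_scaleC_right scaleR_conv_of_real)
  show "\<exists>K. \<forall>x y :: 'a. norm (cinner x y) \<le> norm x * norm y * K"
    by (rule exI[of _ 1]) (simp add: cinner_Cauchy_Schwarz)
qed (simp_all add: cinner_add_left cinner_add_right)

lemma bounded_linear_cinner_right: "bounded_linear (cinner (x :: 'a::chilbert))"
  by (rule bounded_bilinear.bounded_linear_right[OF bounded_bilinear_cinner])

lemma bounded_linear_cinner_left: "bounded_linear (\<lambda>x :: 'a::chilbert. cinner x y)"
  by (rule bounded_bilinear.bounded_linear_left[OF bounded_bilinear_cinner])

section \<open>Orthonormal bases\<close>

definition orthonormal :: "'a::chilbert set \<Rightarrow> bool" where
  "orthonormal E \<longleftrightarrow> (\<forall>e\<in>E. norm e = 1) \<and> (\<forall>e\<in>E. \<forall>f\<in>E. e \<noteq> f \<longrightarrow> cinner e f = 0)"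

lemma orthonormal_basis_iff:
  "orthonormal_basis E \<longleftrightarrow> orthonormal E \<and> (\<forall>x. (\<forall>e\<in>E. cinner e x = 0) \<longrightarrow> x = 0)"
  by (auto simp: orthonormal_basis_def orthonormal_def)

lemma orthonormal_cinner:
  "orthonormal E \<Longrightarrow> e \<in> E \<Longrightarrow> f \<in> E \<Longrightarrow> cinner e f = (if e = f then 1 else 0)"
  by (auto simp: orthonormal_def cinner_self)

text \<open>A maximal orthonormal set is a basis: a nonzero vector orthogonal to it could be normalized
  and added.\<close>

lemma orthonormal_basis_exists: "\<exists>E :: 'a::chilbert set. orthonormal_basis E"
proof -
  have "\<exists>M\<in>{E :: 'a set. orthonormal E}. \<forall>X\<in>{E. orthonormal E}. M \<subseteq> X \<longrightarrow> X = M"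
  proof (rule subset_Zorn', clarify)
    fix C :: "'a set set"
    assume C: "subset.chain {E. orthonormal E} C"
    have "norm e = 1" if "e \<in> \<Union>C" for e
      using that C by (auto simp: subset.chain_def orthonormal_def)
    moreover have "cinner e f = 0" if ef: "e \<in> \<Union>C" "f \<in> \<Union>C" "e \<noteq> f" for e f
    proof -
      obtain A B where AB: "A \<in> C" "B \<in> C" "e \<in> A" "f \<in> B"
        using ef by blast
      then have "A \<subseteq> B \<or> B \<subseteq> A" "orthonormal A" "orthonormal B"
        using C by (auto simp: subset_chain_def)
      then show ?thesis
        using AB \<open>e \<noteq> f\<close> by (auto simp: orthonormal_def)
    qed
    ultimately show "orthonormal (\<Union>C)"
      by (auto simp: orthonormal_def)
  qed
  then obtain M :: "'a set" where M: "orthonormal M" "\<And>X. orthonormal X \<Longrightarrow> M \<subseteq> X \<Longrightarrow> X = M"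
    by auto
  have "x = 0" if x: "\<forall>e\<in>M. cinner e x = 0" for x
  proof (rule ccontr)
    assume "x \<noteq> 0"
    define y where "y = complex_of_real (1 / norm x) *\<^sub>C x"
    have ny: "norm y = 1"
      using \<open>x \<noteq> 0\<close> by (simp add: y_def norm_scaleC norm_divide)
    have ey: "cinner e y = 0" if "e \<in> M" for e
      using x that by (simp add: y_def cinner_scaleC_right)
    moreover have "cinner y e = 0" if "e \<in> M" for e
      using ey[OF that] cinner_commute[of y e] by simp
    ultimately have "orthonormal (insert y M)"
      using M(1) ny by (auto simp: orthonormal_def)
    then have "y \<in> M"
      using M(2)[of "insert y M"] by auto
    then show False
      using ey[of y] ny by (simp add: cinner_self)
  qed
  then show ?thesis
    using M(1) by (auto simp: orthonormal_basis_iff)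
qed

lemma norm_orthonormal_sum:
  assumes "orthonormal E" "finite F" "F \<subseteq> E"
  shows "(norm (\<Sum>e\<in>F. c e *\<^sub>C e))\<^sup>2 = (\<Sum>e\<in>F. (cmod (c e))\<^sup>2)"
  using assms(2,3)
proof (induction F rule: finite_induct)
  case (insert a F)
  have "cinner (c a *\<^sub>C a) (\<Sum>e\<in>F. c e *\<^sub>C e) = (\<Sum>e\<in>F. cnj (c a) * (c e * cinner a e))"
    by (simp add: cinner_scaleC_left cinner_scaleC_right cinner_sum_right sum_distrib_left mult.left_commute)
  also have "\<dots> = 0"
  proof (intro sum.neutral ballI)
    fix e assume "e \<in> F"
    then have "cinner a e = 0"
      using insert orthonormal_cinner[OF assms(1), of a e] by auto
    then show "cnj (c a) * (c e * cinner a e) = 0" by simp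
  qed
  finally have "(norm (c a *\<^sub>C a + (\<Sum>e\<in>F. c e *\<^sub>C e)))\<^sup>2
      = (norm (c a *\<^sub>C a))\<^sup>2 + (norm (\<Sum>e\<in>F. c e *\<^sub>C e))\<^sup>2"
    by (rule norm_add_squared_orthogonal)
  moreover have "norm a = 1"
    using insert assms(1) by (auto simp: orthonormal_def)
  ultimately show ?case
    using insert by (simp add: norm_scaleC)
qed simp

lemma Bessel_inequality:
  assumes "orthonormal E" "finite F" "F \<subseteq> E"
  shows "(\<Sum>e\<in>F. (cmod (cinner e x))\<^sup>2) \<le> (norm x)\<^sup>2"
proof -
  define s where "s = (\<Sum>e\<in>F. cinner e x *\<^sub>C e)"
  have s2: "(norm s)\<^sup>2 = (\<Sum>e\<in>F. (cmod (cinner e x))\<^sup>2)"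
    unfolding s_def by (rule norm_orthonormal_sum[OF assms])
  have "cinner s x = (\<Sum>e\<in>F. cnj (cinner e x) * cinner e x)"
    by (simp add: s_def cinner_sum_left cinner_scaleC_left)
  also have "\<dots> = cinner s s"
    by (simp add: cnj_mult_self cinner_self s2)
  finally have "cinner s (x - s) = 0"
    by (simp add: cinner_diff_right)
  then have "(norm (s + (x - s)))\<^sup>2 = (norm s)\<^sup>2 + (norm (x - s))\<^sup>2"
    by (rule norm_add_squared_orthogonal)
  then show ?thesis
    using s2 by (simp add: algebra_simps)
qed

lemma nonneg_bounded_summable_on:
  fixes f :: "'i \<Rightarrow> real"
  assumes "\<And>x. x \<in> A \<Longrightarrow> f x \<ge> 0" "\<And>F. finite F \<Longrightarrow> F \<subseteq> A \<Longrightarrow> sum f F \<le> K"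
  shows "f summable_on A"
  by (rule nonneg_bdd_above_summable_on) (use assms in \<open>auto intro!: bdd_aboveI[of _ K]\<close>)

text \<open>Square-summable coefficients give a convergent series, although in general not an absolutely
  convergent one: by orthogonality two partial sums whose squared coefficient sums are almost
  maximal differ by little.\<close>

lemma orthonormal_series_summable:
  fixes E :: "'a::chilbert set"
  assumes E: "orthonormal E"
    and bound: "\<And>F. finite F \<Longrightarrow> F \<subseteq> E \<Longrightarrow> (\<Sum>e\<in>F. (cmod (c e))\<^sup>2) \<le> K"
  shows "(\<lambda>e. c e *\<^sub>C e) summable_on E"
proof -
  define f where "f e = c e *\<^sub>C e" for e
  define r where "r e = (cmod (c e))\<^sup>2" for e
  have "r summable_on E"
    by (rule nonneg_bounded_summable_on[of _ _ K]) (use bound in \<open>auto simp: r_def\<close>)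
  then obtain L where L: "(r has_sum L) E"
    by (auto simp: summable_on_def)
  have le_L: "sum r F \<le> L" if "finite F" "F \<subseteq> E" for F
    by (rule finite_sum_le_has_sum[OF L]) (use that in \<open>auto simp: r_def\<close>)
  have "\<exists>P. eventually P (finite_subsets_at_top E) \<and>
              (\<forall>F F'. P F \<and> P F' \<longrightarrow> dist (sum f F) (sum f F') < \<epsilon>)" if "\<epsilon> > 0" for \<epsilon>
  proof -
    define \<delta> where "\<delta> = \<epsilon>\<^sup>2 / 2"
    have "\<delta> > 0" using that by (simp add: \<delta>_def)
    define P where "P F \<longleftrightarrow> finite F \<and> F \<subseteq> E \<and> dist (sum r F) L < \<delta>" for F
    have ev: "eventually P (finite_subsets_at_top E)"
      using L \<open>\<delta> > 0\<close> unfolding has_sum_def P_def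
      by (auto simp: tendsto_iff eventually_conj_iff eventually_finite_subsets_at_top_weakI)
    have "dist (sum f F) (sum f G) < \<epsilon>" if "P F" "P G" for F G
    proof -
      have fin: "finite F" "finite G" "F \<subseteq> E" "G \<subseteq> E"
        using that by (auto simp: P_def)
      have "sum f F = sum f (F - G) + sum f (F \<inter> G)" "sum f G = sum f (G - F) + sum f (F \<inter> G)"
        using sum.Int_Diff[OF fin(1), of f G] sum.Int_Diff[OF fin(2), of f F]
        by (simp_all add: Int_commute add.commute)
      then have "sum f F - sum f G = sum f (F - G) - sum f (G - F)"
        by simp
      also have "\<dots> = (\<Sum>e\<in>(F - G) \<union> (G - F). (if e \<in> F then c e else - c e) *\<^sub>C e)"
      proof -
        have "sum f (F - G) = (\<Sum>e\<in>F - G. (if e \<in> F then c e else - c e) *\<^sub>C e)"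
          by (rule sum.cong) (auto simp: f_def)
        moreover have "- sum f (G - F) = (\<Sum>e\<in>G - F. (if e \<in> F then c e else - c e) *\<^sub>C e)"
          unfolding sum_negf[symmetric]
          by (rule sum.cong)
            (auto simp: f_def scaleC_minus_one scaleC_scaleC simp flip: scaleC_minus_one)
        ultimately show ?thesis
          using fin by (subst sum.union_disjoint) auto
      qed
      finally have "(norm (sum f F - sum f G))\<^sup>2
          = (\<Sum>e\<in>(F - G) \<union> (G - F). (cmod (if e \<in> F then c e else - c e))\<^sup>2)"
        using fin by (simp only:) (intro norm_orthonormal_sum[OF E], auto)
      also have "\<dots> = sum r (F - G) + sum r (G - F)"
      proof -
        have "(\<Sum>e\<in>F - G. (cmod (if e \<in> F then c e else - c e))\<^sup>2) = sum r (F - G)"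
          "(\<Sum>e\<in>G - F. (cmod (if e \<in> F then c e else - c e))\<^sup>2) = sum r (G - F)"
          by (rule sum.cong; simp add: r_def)+
        then show ?thesis
          using fin by (subst sum.union_disjoint) auto
      qed
      also have "\<dots> < \<delta> + \<delta>"
      proof -
        have "sum r F + sum r (G - F) \<le> L" "sum r G + sum r (F - G) \<le> L"
          using le_L[of "F \<union> G"] fin sum.union_disjoint[of F "G - F" r] sum.union_disjoint[of G "F - G" r]
          by (simp_all add: Un_commute)
        moreover have "sum r F > L - \<delta>" "sum r G > L - \<delta>"
          using that by (auto simp: P_def dist_real_def)
        ultimately show ?thesis by linarith
      qed
      finally have "(norm (sum f F - sum f G))\<^sup>2 < \<epsilon>\<^sup>2"
        by (simp add: \<delta>_def)
      then show ?thesis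
        using \<open>\<epsilon> > 0\<close> power2_less_imp_less[of "norm (sum f F - sum f G)" \<epsilon>]
        by (simp add: dist_norm)
    qed
    then show ?thesis using ev by blast
  qed
  then have "cauchy_filter (filtermap (sum f) (finite_subsets_at_top E))"
    by (simp add: cauchy_filter_metric_filtermap)
  moreover have "complete (UNIV :: 'a set)"
    by (meson Cauchy_convergent UNIV_I complete_def convergent_def)
  ultimately obtain L' where "(sum f \<longlongrightarrow> L') (finite_subsets_at_top E)"
    using complete_uniform[where S = "UNIV :: 'a set"] by (force simp add: filterlim_def)
  then show ?thesis
    unfolding f_def[symmetric] using summable_on_def has_sum_def by blast
qed

lemma cinner_orthonormal_series:
  assumes E: "orthonormal E" and s: "((\<lambda>e. c e *\<^sub>C e) has_sum s) E" and a: "a \<in> E"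
  shows "cinner a s = c a"
proof -
  have "((\<lambda>e. cinner a (c e *\<^sub>C e)) has_sum cinner a s) E"
    by (rule has_sum_bounded_linear[OF bounded_linear_cinner_right s])
  moreover have "((\<lambda>e. cinner a (c e *\<^sub>C e)) has_sum c a) E"
  proof (rule has_sum_finite_neutralI[of "{a}"])
    show "cinner a (c e *\<^sub>C e) = 0" if "e \<in> E - {a}" for e
      using orthonormal_cinner[OF E a, of e] that by (auto simp: cinner_scaleC_right)
    show "c a = (\<Sum>e\<in>{a}. cinner a (c e *\<^sub>C e))"
      using orthonormal_cinner[OF E a a] by (simp add: cinner_scaleC_right)
  qed (use a in auto)
  ultimately show ?thesis
    by (rule has_sum_unique)
qed

lemma orthonormal_basis_expansion:
  assumes "orthonormal_basis E"
  shows "((\<lambda>e. cinner e x *\<^sub>C e) has_sum x) E"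
proof -
  have E: "orthonormal E"
    using assms by (simp add: orthonormal_basis_iff)
  have "(\<lambda>e. cinner e x *\<^sub>C e) summable_on E"
    by (rule orthonormal_series_summable[OF E, of _ "(norm x)\<^sup>2"]) (rule Bessel_inequality[OF E])
  then obtain s where s: "((\<lambda>e. cinner e x *\<^sub>C e) has_sum s) E"
    by (auto simp: summable_on_def)
  have "cinner e (x - s) = 0" if "e \<in> E" for e
    using cinner_orthonormal_series[OF E s that] by (simp add: cinner_diff_right)
  then have "x - s = 0"
    using assms unfolding orthonormal_basis_iff by blast
  then show ?thesis using s by simp
qed

lemma Parseval_identity:
  assumes "orthonormal_basis E"
  shows "((\<lambda>e. cinner x e * cinner e y) has_sum cinner x y) E"
  using has_sum_bounded_linear[OF bounded_linear_cinner_right orthonormal_basis_expansion[OF assms], of x y]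
  by (simp add: cinner_scaleC_right mult.commute)

lemma Parseval_norm:
  assumes "orthonormal_basis E"
  shows "((\<lambda>e. (cmod (cinner e x))\<^sup>2) has_sum (norm x)\<^sup>2) E"
proof -
  have "cinner x e * cinner e x = complex_of_real ((cmod (cinner e x))\<^sup>2)" for e
    by (metis cinner_commute cnj_mult_self)
  then have "((\<lambda>e. complex_of_real ((cmod (cinner e x))\<^sup>2)) has_sum complex_of_real ((norm x)\<^sup>2)) E"
    using Parseval_identity[OF assms, of x x] by (simp add: cinner_self)
  then show ?thesis
    by (simp only: has_sum_of_real_iff)
qed

text \<open>The representing vector has the coefficients \<open>cnj (\<phi> e)\<close>; they are square-summable because
  \<open>\<phi> s = \<parallel>s\<parallel>\<^sup>2\<close> for each partial sum \<open>s\<close>, so that \<open>\<parallel>s\<parallel> \<le> \<parallel>\<phi>\<parallel>\<close>.\<close>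

lemma Riesz_representation:
  fixes \<phi> :: "'a::chilbert \<Rightarrow> complex"
  assumes "bounded_linear \<phi>" and scaleC: "\<And>c x. \<phi> (c *\<^sub>C x) = c * \<phi> x"
  obtains w where "\<And>x. \<phi> x = cinner w x"
proof -
  interpret \<phi>: bounded_linear \<phi> by fact
  obtain K where K: "K \<ge> 0" "\<And>x. norm (\<phi> x) \<le> norm x * K"
    using \<phi>.nonneg_bounded by blast
  obtain E :: "'a set" where basis: "orthonormal_basis E"
    using orthonormal_basis_exists by blast
  then have E: "orthonormal E"
    by (simp add: orthonormal_basis_iff)
  have "(\<Sum>e\<in>F. (cmod (cnj (\<phi> e)))\<^sup>2) \<le> K\<^sup>2" if F: "finite F" "F \<subseteq> E" for F
  proof -
    define s where "s = (\<Sum>e\<in>F. cnj (\<phi> e) *\<^sub>C e)"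
    have s2: "(norm s)\<^sup>2 = (\<Sum>e\<in>F. (cmod (cnj (\<phi> e)))\<^sup>2)"
      unfolding s_def by (rule norm_orthonormal_sum[OF E F])
    have "\<phi> s = (\<Sum>e\<in>F. cnj (\<phi> e) * \<phi> e)"
      by (simp add: s_def \<phi>.sum scaleC)
    also have "\<dots> = complex_of_real ((norm s)\<^sup>2)"
      by (simp add: cnj_mult_self s2)
    finally have "cmod (\<phi> s) = (norm s)\<^sup>2"
      by (simp add: norm_power)
    then have "norm s * norm s \<le> norm s * K"
      using K(2)[of s] by (simp add: power2_eq_square)
    then have "norm s \<le> K"
      using K(1) by (cases "s = 0") auto
    then show ?thesis
      using s2 by (metis norm_ge_zero power_mono)
  qed
  then have "(\<lambda>e. cnj (\<phi> e) *\<^sub>C e) summable_on E"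
    by (rule orthonormal_series_summable[OF E])
  then obtain w where w: "((\<lambda>e. cnj (\<phi> e) *\<^sub>C e) has_sum w) E"
    by (auto simp: summable_on_def)
  have "\<phi> x = cinner w x" for x
  proof -
    have "((\<lambda>e. \<phi> (cinner e x *\<^sub>C e)) has_sum \<phi> x) E"
      by (rule has_sum_bounded_linear[OF assms(1) orthonormal_basis_expansion[OF basis]])
    moreover have "((\<lambda>e. cinner (cnj (\<phi> e) *\<^sub>C e) x) has_sum cinner w x) E"
      by (rule has_sum_bounded_linear[OF bounded_linear_cinner_left w])
    ultimately show ?thesis
      using has_sum_unique by (fastforce simp: scaleC cinner_scaleC_left mult.commute)
  qed
  then show thesis by (rule that)
qed

section \<open>Bounded operators and adjoints\<close>

lemma bounded_opsD: "A \<in> bounded_ops \<Longrightarrow> blinfun_apply A (c *\<^sub>C x) = c *\<^sub>C blinfun_apply A x"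
  by (simp add: bounded_ops_def)

lemma bounded_opsI:
  "(\<And>c x. blinfun_apply A (c *\<^sub>C x) = c *\<^sub>C blinfun_apply A x) \<Longrightarrow> A \<in> bounded_ops"
  by (simp add: bounded_ops_def)

lemma scale_op_apply [simp]: "blinfun_apply (scale_op c A) x = c *\<^sub>C blinfun_apply A x"
  by transfer simp

lemma scaleR_scaleC_commute: "r *\<^sub>R (c *\<^sub>C x) = c *\<^sub>C (r *\<^sub>R (x :: 'a::chilbert))"
  by (simp add: scaleR_scaleC scaleC_scaleC mult.commute)

lemma bounded_ops_closure [intro, simp]:
  fixes A B :: "'a::chilbert \<Rightarrow>\<^sub>L 'a"
  shows zero_in_bounded_ops: "0 \<in> (bounded_ops :: ('a \<Rightarrow>\<^sub>L 'a) set)"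
    and id_in_bounded_ops: "id_blinfun \<in> (bounded_ops :: ('a \<Rightarrow>\<^sub>L 'a) set)"
    and "A \<in> bounded_ops \<Longrightarrow> B \<in> bounded_ops \<Longrightarrow> A + B \<in> bounded_ops"
    and "A \<in> bounded_ops \<Longrightarrow> B \<in> bounded_ops \<Longrightarrow> A - B \<in> bounded_ops"
    and "A \<in> bounded_ops \<Longrightarrow> B \<in> bounded_ops \<Longrightarrow> A o\<^sub>L B \<in> bounded_ops"
    and "A \<in> bounded_ops \<Longrightarrow> scale_op c A \<in> bounded_ops"
    and "A \<in> bounded_ops \<Longrightarrow> r *\<^sub>R A \<in> bounded_ops"
  by (auto simp: bounded_ops_def blinfun.add_left blinfun.diff_left blinfun.scaleR_left
      scaleC_add_right scaleC_diff_right scaleC_scaleC mult.commute scaleR_scaleC_commute)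

lemma adjoint_exists:
  fixes A :: "'a::chilbert \<Rightarrow>\<^sub>L 'a"
  assumes A: "A \<in> bounded_ops"
  shows "\<exists>B\<in>bounded_ops. \<forall>x y. cinner (blinfun_apply B x) y = cinner x (blinfun_apply A y)"
proof -
  have "\<exists>w. \<forall>y. cinner x (blinfun_apply A y) = cinner w y" for x
  proof (rule Riesz_representation[of "\<lambda>y. cinner x (blinfun_apply A y)"])
    show "bounded_linear (\<lambda>y. cinner x (blinfun_apply A y))"
      by (rule bounded_linear_compose[OF bounded_linear_cinner_right blinfun.bounded_linear_right])
    show "cinner x (blinfun_apply A (c *\<^sub>C y)) = c * cinner x (blinfun_apply A y)" for c y
      by (simp add: bounded_opsD[OF A] cinner_scaleC_right)
  qed blast
  then obtain g where g: "\<And>x y. cinner x (blinfun_apply A y) = cinner (g x) y"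
    by metis
  have eqI: "u = v" if "\<And>y. cinner u y = cinner v y" for u v :: 'a
    by (rule cinner_eqI) (metis cinner_commute that)
  have gC: "g (c *\<^sub>C x) = c *\<^sub>C g x" for c x
    by (rule eqI) (simp add: cinner_scaleC_left flip: g)
  have "bounded_linear g"
  proof (rule bounded_linear_intro)
    show "g (x + y) = g x + g y" for x y
      by (rule eqI) (simp add: cinner_add_left flip: g)
    show "g (r *\<^sub>R x) = r *\<^sub>R g x" for r x
      by (simp add: scaleR_scaleC gC)
    show "norm (g x) \<le> norm x * norm A" for x
    proof -
      have "norm (g x) * norm (g x) = cmod (cinner (g x) (g x))"
        by (simp only: cinner_self norm_of_real power2_eq_square) simp
      also have "\<dots> = cmod (cinner x (blinfun_apply A (g x)))"
        by (simp add: g)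
      also have "\<dots> \<le> norm x * norm (blinfun_apply A (g x))"
        by (rule cinner_Cauchy_Schwarz)
      also have "\<dots> \<le> norm x * (norm A * norm (g x))"
        by (intro mult_left_mono norm_blinfun) simp
      finally show ?thesis
        by (cases "norm (g x) = 0") (simp_all flip: mult.assoc)
    qed
  qed
  then have "blinfun_apply (Blinfun g) = g"
    by (rule bounded_linear_Blinfun_apply)
  then show ?thesis
    by (intro bexI[of _ "Blinfun g"]) (simp_all add: g bounded_opsI gC)
qed

lemma adj_eqI:
  assumes "B \<in> bounded_ops" "\<And>x y. cinner (blinfun_apply B x) y = cinner x (blinfun_apply A y)"
  shows "adj A = B"
  unfolding adj_def
proof (rule the_equality)
  fix C assume C: "C \<in> bounded_ops \<and> (\<forall>x y. cinner (blinfun_apply C x) y = cinner x (blinfun_apply A y))"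
  show "C = B"
  proof (rule blinfun_eqI, rule cinner_eqI)
    fix x z
    have "cinner (blinfun_apply C x) z = cinner (blinfun_apply B x) z"
      using C assms by simp
    then show "cinner z (blinfun_apply C x) = cinner z (blinfun_apply B x)"
      by (metis cinner_commute)
  qed
qed (use assms in blast)

lemma adj_bounded_ops [intro, simp]: "A \<in> bounded_ops \<Longrightarrow> adj A \<in> bounded_ops"
  and cinner_adj_left: "A \<in> bounded_ops \<Longrightarrow>
    cinner (blinfun_apply (adj A) x) y = cinner x (blinfun_apply A y)"
  using adjoint_exists[of A] adj_eqI[of _ A] by blast+

lemma cinner_adj_right:
  "A \<in> bounded_ops \<Longrightarrow> cinner x (blinfun_apply (adj A) y) = cinner (blinfun_apply A x) y"
  by (metis cinner_adj_left cinner_commute)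

lemma adj_adj [simp]: "A \<in> bounded_ops \<Longrightarrow> adj (adj A) = A"
  by (rule adj_eqI) (simp_all add: cinner_adj_right)

lemma adj_compose: "A \<in> bounded_ops \<Longrightarrow> B \<in> bounded_ops \<Longrightarrow> adj (A o\<^sub>L B) = adj B o\<^sub>L adj A"
  by (rule adj_eqI) (simp_all add: cinner_adj_left)

lemma adj_add: "A \<in> bounded_ops \<Longrightarrow> B \<in> bounded_ops \<Longrightarrow> adj (A + B) = adj A + adj B"
  by (rule adj_eqI) (simp_all add: cinner_adj_left blinfun.add_left cinner_add_left cinner_add_right)

lemma adj_scale_op: "A \<in> bounded_ops \<Longrightarrow> adj (scale_op c A) = scale_op (cnj c) (adj A)"
  by (rule adj_eqI) (simp_all add: cinner_adj_left cinner_scaleC_left cinner_scaleC_right)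

lemma adj_zero [simp]: "adj 0 = 0"
  by (rule adj_eqI) simp_all

lemma adj_id [simp]: "adj id_blinfun = id_blinfun"
  by (rule adj_eqI) simp_all

section \<open>Positive operators\<close>

text \<open>Over the complex numbers a real quadratic form forces a Hermitian sesquilinear form: compare
  the values at \<open>x + y\<close> and at \<open>x + i y\<close>.\<close>

lemma symmetric_if_real_form:
  assumes A: "A \<in> bounded_ops" and real: "\<And>x. Im (cinner x (blinfun_apply A x)) = 0"
  shows "cinner (blinfun_apply A x) y = cinner x (blinfun_apply A y)"
proof -
  define p q where "p = cinner x (blinfun_apply A y)" and "q = cinner y (blinfun_apply A x)"
  have "Im p + Im q = 0"
    using real[of "x + y"] real[of x] real[of y]
    by (simp add: blinfun.add_right cinner_add_left cinner_add_right p_def q_def)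
  moreover have "Re p - Re q = 0"
    using real[of "x + \<i> *\<^sub>C y"] real[of x] real[of y]
    by (simp add: blinfun.add_right cinner_add_left cinner_add_right p_def q_def
        bounded_opsD[OF A] cinner_scaleC_left cinner_scaleC_right)
  ultimately have "cnj q = p"
    by (simp add: complex_eq_iff)
  then show ?thesis
    unfolding p_def q_def by (metis cinner_commute)
qed

lemma positive_op_iff:
  "positive_op P \<longleftrightarrow> P \<in> bounded_ops \<and>
    (\<forall>x. Re (cinner x (blinfun_apply P x)) \<ge> 0 \<and> Im (cinner x (blinfun_apply P x)) = 0)"
  by (simp add: positive_op_def complex_nonneg_Reals_iff)

lemma positive_op_bounded [intro, simp]: "positive_op P \<Longrightarrow> P \<in> bounded_ops"
  by (simp add: positive_op_iff)

lemma positive_op_symmetric: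
  "positive_op P \<Longrightarrow> cinner (blinfun_apply P x) y = cinner x (blinfun_apply P y)"
  by (rule symmetric_if_real_form) (simp_all add: positive_op_iff)

lemma positive_opI:
  assumes "P \<in> bounded_ops"
    and sym: "\<And>x y. cinner (blinfun_apply P x) y = cinner x (blinfun_apply P y)"
    and "\<And>x. Re (cinner x (blinfun_apply P x)) \<ge> 0"
  shows "positive_op P"
proof -
  have "Im (cinner x (blinfun_apply P x)) = 0" for x
    using arg_cong[OF cinner_commute[of x "blinfun_apply P x"], of Im] sym[of x x] by simp
  then show ?thesis
    using assms by (simp add: positive_op_iff)
qed

lemma adj_positive: "positive_op P \<Longrightarrow> adj P = P"
  by (rule adj_eqI) (simp_all add: positive_op_symmetric)

lemma positive_op_Cauchy_Schwarz:
  assumes P: "positive_op P"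
  shows "(cmod (cinner x (blinfun_apply P y)))\<^sup>2
    \<le> Re (cinner x (blinfun_apply P x)) * Re (cinner y (blinfun_apply P y))"
proof (rule quadratic_form_discriminant)
  fix c
  have "Re (cinner y (blinfun_apply P x) * cnj c) = Re (c * cinner x (blinfun_apply P y))"
    using arg_cong[OF cinner_commute[of "blinfun_apply P y" x], of Re]
      arg_cong[OF cinner_commute[of "blinfun_apply P y" x], of Im]
    by (simp add: positive_op_symmetric[OF P] algebra_simps)
  moreover have "cinner (x + c *\<^sub>C y) (blinfun_apply P (x + c *\<^sub>C y))
      = cinner x (blinfun_apply P x) + (c * cinner x (blinfun_apply P y)
        + cinner y (blinfun_apply P x) * cnj c) + (cnj c * c) * cinner y (blinfun_apply P y)"
    using P by (simp add: blinfun.add_right bounded_opsD cinner_add_left cinner_add_right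
        cinner_scaleC_left cinner_scaleC_right algebra_simps)
  ultimately have "Re (cinner (x + c *\<^sub>C y) (blinfun_apply P (x + c *\<^sub>C y)))
      = Re (cinner x (blinfun_apply P x)) + 2 * Re (c * cinner x (blinfun_apply P y))
        + Re ((cnj c * c) * cinner y (blinfun_apply P y))"
    by (simp only: plus_complex.sel)
  also have "Re ((cnj c * c) * cinner y (blinfun_apply P y))
      = (cmod c)\<^sup>2 * Re (cinner y (blinfun_apply P y))"
    by (simp only: cnj_mult_self Re_complex_of_real) simp
  finally show "0 \<le> Re (cinner x (blinfun_apply P x)) + 2 * Re (c * cinner x (blinfun_apply P y))
        + (cmod c)\<^sup>2 * Re (cinner y (blinfun_apply P y))"
    using P by (metis positive_op_iff)
qed (use P in \<open>simp add: positive_op_iff\<close>)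

lemma Re_cinner_le_norm: "Re (cinner x (blinfun_apply A y)) \<le> norm A * norm x * norm y"
proof -
  have "Re (cinner x (blinfun_apply A y)) \<le> cmod (cinner x (blinfun_apply A y))"
    by (rule complex_Re_le_cmod)
  also have "\<dots> \<le> norm x * norm (blinfun_apply A y)"
    by (rule cinner_Cauchy_Schwarz)
  also have "\<dots> \<le> norm x * (norm A * norm y)"
    by (intro mult_left_mono norm_blinfun) simp
  finally show ?thesis by (simp add: mult_ac)
qed

lemma positive_op_norm_squared_le:
  assumes P: "positive_op P"
  shows "(norm (blinfun_apply P x))\<^sup>2 \<le> norm P * Re (cinner x (blinfun_apply P x))"
proof -
  define y where "y = blinfun_apply P x"
  have "((norm y)\<^sup>2)\<^sup>2 = (cmod (cinner y (blinfun_apply P x)))\<^sup>2"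
    by (simp add: y_def cinner_self norm_power)
  also have "\<dots> \<le> Re (cinner y (blinfun_apply P y)) * Re (cinner x (blinfun_apply P x))"
    by (rule positive_op_Cauchy_Schwarz[OF P])
  also have "\<dots> \<le> (norm P * norm y * norm y) * Re (cinner x (blinfun_apply P x))"
    by (intro mult_right_mono Re_cinner_le_norm) (use P in \<open>simp add: positive_op_iff\<close>)
  finally have "(norm y)\<^sup>2 * (norm y)\<^sup>2 \<le> (norm y)\<^sup>2 * (norm P * Re (cinner x (blinfun_apply P x)))"
    by (simp add: power2_eq_square mult_ac)
  moreover have "0 \<le> norm P * Re (cinner x (blinfun_apply P x))"
    using P by (simp add: positive_op_iff)
  ultimately have "(norm y)\<^sup>2 \<le> norm P * Re (cinner x (blinfun_apply P x))"
    using mult_le_cancel_left_pos[of "(norm y)\<^sup>2" "(norm y)\<^sup>2"] by (cases "y = 0") fastforce+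
  then show ?thesis
    by (simp only: y_def)
qed

text \<open>Put \<open>D = A - B\<close> and \<open>S = A + B\<close>. Then \<open>S D + D S = 2 (A\<^sup>2 - B\<^sup>2) = 0\<close>. If \<open>D \<noteq> 0\<close>, choose a unit
  vector \<open>x\<close> at which \<open>\<parallel>D x\<parallel>\<close> almost attains \<open>\<parallel>D\<parallel>\<close>, so that \<open>D\<^sup>2 x \<approx> \<parallel>D\<parallel>\<^sup>2 x\<close>. From
  \<open>\<langle>x, S D\<^sup>2 x\<rangle> = - \<langle>D x, S D x\<rangle> \<le> 0\<close> we get \<open>\<langle>x, S x\<rangle> \<approx> 0\<close>; as both \<open>\<langle>x, A x\<rangle>\<close> and \<open>\<langle>x, B x\<rangle>\<close> are
  nonnegative, \<open>A x \<approx> 0\<close> and \<open>B x \<approx> 0\<close>, against \<open>\<parallel>D x\<parallel> \<approx> \<parallel>D\<parallel>\<close>.\<close>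

lemma positive_sqrt_unique:
  fixes A B :: "'a::chilbert \<Rightarrow>\<^sub>L 'a"
  assumes A: "positive_op A" and B: "positive_op B" and eq: "A o\<^sub>L A = B o\<^sub>L B"
  shows "A = B"
proof (rule ccontr)
  assume "A \<noteq> B"
  define D S d where "D = A - B" and "S = A + B" and "d = norm D"
  have "d > 0"
    using \<open>A \<noteq> B\<close> by (simp add: d_def D_def)
  \<comment> \<open>If \<open>\<parallel>D x\<parallel>\<^sup>2 > d\<^sup>2 - s\<^sup>2\<close> for a unit vector \<open>x\<close>, the estimates below give \<open>\<parallel>D x\<parallel>\<^sup>2 \<le> K s\<close>; so \<open>s\<close> is taken
    small enough for \<open>s\<^sup>2 + K s < d\<^sup>2\<close>.\<close>
  define K where "K = 2 * (norm A + norm B) * norm S / d"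
  have "K \<ge> 0"
    using \<open>d > 0\<close> by (simp add: K_def)
  define s where "s = min 1 (d\<^sup>2 / (2 * (1 + K)))"
  have s: "0 < s" "s \<le> 1"
    using \<open>K \<ge> 0\<close> \<open>d > 0\<close> by (auto simp: s_def add_pos_nonneg)
  have "s * (1 + K) \<le> d\<^sup>2 / 2"
  proof -
    have "s * (1 + K) \<le> d\<^sup>2 / (2 * (1 + K)) * (1 + K)"
      using \<open>K \<ge> 0\<close> by (intro mult_right_mono) (simp_all add: s_def)
    also have "\<dots> = d\<^sup>2 / 2"
      using \<open>K \<ge> 0\<close> by (simp add: field_simps)
    finally show ?thesis .
  qed
  moreover have "s\<^sup>2 \<le> s"
    using s by (simp add: power2_eq_square mult_left_le)
  moreover have "d\<^sup>2 > 0" using \<open>d > 0\<close> by simp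
  moreover have "s * (1 + K) = s + K * s"
    by (simp add: algebra_simps)
  ultimately have sK: "s\<^sup>2 + K * s < d\<^sup>2"
    by linarith
  have D_sym: "cinner (blinfun_apply D x) y = cinner x (blinfun_apply D y)" for x y
    by (simp add: D_def blinfun.diff_left cinner_diff_left cinner_diff_right
        positive_op_symmetric[OF A] positive_op_symmetric[OF B])
  have S_pos: "Re (cinner x (blinfun_apply S x)) \<ge> 0" for x
    using A B by (simp add: S_def blinfun.add_left cinner_add_right positive_op_iff)
  have "blinfun_apply A (blinfun_apply A x) = blinfun_apply B (blinfun_apply B x)" for x
    using arg_cong[OF eq, of "\<lambda>T. blinfun_apply T x"] by simp
  then have anticommute: "blinfun_apply S (blinfun_apply D x) = - blinfun_apply D (blinfun_apply S x)" for x
    by (simp add: S_def D_def blinfun.add_left blinfun.diff_left blinfun.add_right blinfun.diff_right)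
  have unit: "(norm (blinfun_apply D x))\<^sup>2 \<le> d\<^sup>2 - s\<^sup>2" if x: "norm x = 1" for x
  proof (rule ccontr)
    assume "\<not> ?thesis"
    then have large: "(norm (blinfun_apply D x))\<^sup>2 > d\<^sup>2 - s\<^sup>2" by simp
    define y where "y = blinfun_apply D x"
    define r where "r = blinfun_apply D y - d\<^sup>2 *\<^sub>R x"
    have "norm (blinfun_apply D y) \<le> d * norm y"
      unfolding d_def by (rule norm_blinfun)
    then have "(norm (blinfun_apply D y))\<^sup>2 \<le> d\<^sup>2 * (norm y)\<^sup>2"
      by (metis norm_ge_zero power_mono power_mult_distrib)
    moreover have "(norm r)\<^sup>2 = (norm (blinfun_apply D y))\<^sup>2 - 2 * d\<^sup>2 * (norm y)\<^sup>2 + d\<^sup>2 * d\<^sup>2"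
    proof -
      have "cinner (blinfun_apply D y) (d\<^sup>2 *\<^sub>R x) = complex_of_real (d\<^sup>2 * (norm y)\<^sup>2)"
        by (simp add: D_sym scaleR_scaleC bounded_opsD cinner_scaleC_right cinner_self
            blinfun.scaleR_right bounded_bilinear.scaleR_right[OF bounded_bilinear_cinner]
            flip: y_def)
      then show ?thesis
        using norm_add_squared[of "blinfun_apply D y" "- (d\<^sup>2 *\<^sub>R x)"] x
        by (simp add: r_def power_mult_distrib power2_eq_square)
    qed
    ultimately have "(norm r)\<^sup>2 \<le> d\<^sup>2 * (d\<^sup>2 - (norm y)\<^sup>2)"
      by (simp add: algebra_simps)
    also have "\<dots> \<le> d\<^sup>2 * s\<^sup>2"
      using large by (intro mult_left_mono) (simp_all add: y_def)
    finally have "(norm r)\<^sup>2 \<le> (d * s)\<^sup>2"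
      by (simp add: power_mult_distrib)
    then have r: "norm r \<le> d * s"
      by (rule power2_le_imp_le) (use \<open>d > 0\<close> s in simp)
    have "Re (cinner x (blinfun_apply S (blinfun_apply D y))) = - Re (cinner y (blinfun_apply S y))"
      by (simp add: anticommute y_def D_sym blinfun.minus_right)
    moreover have "blinfun_apply D y = d\<^sup>2 *\<^sub>R x + r"
      by (simp add: r_def)
    ultimately have "Re (cinner x (blinfun_apply S (d\<^sup>2 *\<^sub>R x + r))) \<le> 0"
      using S_pos[of y] by simp
    moreover have "cinner x (blinfun_apply S (d\<^sup>2 *\<^sub>R x + r))
        = d\<^sup>2 *\<^sub>R cinner x (blinfun_apply S x) - cinner x (blinfun_apply S (- r))"
      by (simp add: blinfun.add_right cinner_add_right blinfun.scaleR_right blinfun.minus_right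
          bounded_bilinear.scaleR_right[OF bounded_bilinear_cinner])
    ultimately have "d\<^sup>2 * Re (cinner x (blinfun_apply S x)) \<le> Re (cinner x (blinfun_apply S (- r)))"
      by simp
    also have "\<dots> \<le> norm S * norm x * norm (- r)"
      by (rule Re_cinner_le_norm)
    also have "\<dots> \<le> norm S * (d * s)"
      using r x by (simp add: mult_left_mono)
    finally have "d * (d * Re (cinner x (blinfun_apply S x))) \<le> d * (norm S * s)"
      by (simp add: power2_eq_square mult_ac)
    then have Sx: "Re (cinner x (blinfun_apply S x)) \<le> norm S * s / d"
      using \<open>d > 0\<close> by (simp add: field_simps)
    have "(norm (blinfun_apply D x))\<^sup>2 \<le> 2 * (norm (blinfun_apply A x))\<^sup>2 + 2 * (norm (blinfun_apply B x))\<^sup>2"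
    proof -
      have "norm (blinfun_apply D x) \<le> norm (blinfun_apply A x) + norm (blinfun_apply B x)"
        by (simp add: D_def blinfun.diff_left norm_triangle_ineq4)
      then have "(norm (blinfun_apply D x))\<^sup>2 \<le> (norm (blinfun_apply A x) + norm (blinfun_apply B x))\<^sup>2"
        by (intro power_mono) simp_all
      then show ?thesis
        using zero_le_power2[of "norm (blinfun_apply A x) - norm (blinfun_apply B x)"]
        unfolding power2_sum power2_diff by linarith
    qed
    also have "\<dots> \<le> 2 * (norm A * Re (cinner x (blinfun_apply S x)))
        + 2 * (norm B * Re (cinner x (blinfun_apply S x)))"
    proof -
      have "Re (cinner x (blinfun_apply A x)) \<le> Re (cinner x (blinfun_apply S x))"
        "Re (cinner x (blinfun_apply B x)) \<le> Re (cinner x (blinfun_apply S x))"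
        using A B by (simp_all add: S_def blinfun.add_left cinner_add_right positive_op_iff)
      then have "norm A * Re (cinner x (blinfun_apply A x)) \<le> norm A * Re (cinner x (blinfun_apply S x))"
        "norm B * Re (cinner x (blinfun_apply B x)) \<le> norm B * Re (cinner x (blinfun_apply S x))"
        by (simp_all add: mult_left_mono)
      then show ?thesis
        using positive_op_norm_squared_le[OF A, of x] positive_op_norm_squared_le[OF B, of x]
        by linarith
    qed
    also have "\<dots> = 2 * (norm A + norm B) * Re (cinner x (blinfun_apply S x))"
      by (simp add: algebra_simps)
    also have "\<dots> \<le> 2 * (norm A + norm B) * (norm S * s / d)"
      using Sx by (intro mult_left_mono) simp_all
    also have "\<dots> = K * s"
      by (simp add: K_def)
    finally show False
      using large sK by linarith
  qed
  have "norm D \<le> sqrt (d\<^sup>2 - s\<^sup>2)"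
  proof (rule norm_blinfun_bound)
    have "0 \<le> K * s" using \<open>K \<ge> 0\<close> s by simp
    then show "0 \<le> sqrt (d\<^sup>2 - s\<^sup>2)"
      using sK by simp
    fix x :: 'a
    show "norm (blinfun_apply D x) \<le> sqrt (d\<^sup>2 - s\<^sup>2) * norm x"
    proof (cases "x = 0")
      case False
      have "norm (blinfun_apply D x /\<^sub>R norm x) \<le> sqrt (d\<^sup>2 - s\<^sup>2)"
        using unit[of "x /\<^sub>R norm x"] False
        by (intro real_le_rsqrt) (simp add: blinfun.scaleR_right)
      then show ?thesis
        using False by (simp add: field_simps)
    qed simp
  qed
  then have "d\<^sup>2 \<le> d\<^sup>2 - s\<^sup>2"
    using \<open>d > 0\<close> real_sqrt_unique
    by (metis d_def norm_ge_zero real_sqrt_le_iff real_sqrt_unique)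
  then show False using s by simp
qed

lemma abs_op_eqI:
  assumes "positive_op P" "P o\<^sub>L P = adj A o\<^sub>L A"
  shows "abs_op A = P"
  unfolding abs_op_def
proof (rule the_equality)
  show "Q = P" if "positive_op Q \<and> Q o\<^sub>L Q = adj A o\<^sub>L A" for Q
    using positive_sqrt_unique[of Q P] that assms by simp
qed (use assms in simp)

lemma abs_op_positive: "positive_op P \<Longrightarrow> abs_op P = P"
  by (rule abs_op_eqI) (simp_all add: adj_positive)

lemma closed_bounded_ops: "closed (bounded_ops :: ('a::chilbert \<Rightarrow>\<^sub>L 'a) set)"
  unfolding bounded_ops_def
  by (intro closed_Collect_all closed_Collect_eq continuous_intros
      bounded_linear.continuous_on[OF bounded_linear_scaleC])

text \<open>The scalar recursion \<open>t \<mapsto> (1 + t\<^sup>2) / 2\<close>, started at \<open>0\<close>, increases to \<open>1\<close>. It dominates the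
  operator recursion \<open>X \<mapsto> (B + X\<^sup>2) / 2\<close> for \<open>\<parallel>B\<parallel> \<le> 1\<close>, which therefore converges in norm, and its
  limit \<open>L\<close> satisfies \<open>(1 - L)\<^sup>2 = 1 - B\<close>.\<close>

primrec sqrt_majorant :: "nat \<Rightarrow> real" where
  "sqrt_majorant 0 = 0"
| "sqrt_majorant (Suc n) = (1 + (sqrt_majorant n)\<^sup>2) / 2"

primrec sqrt_iter :: "('a::chilbert \<Rightarrow>\<^sub>L 'a) \<Rightarrow> nat \<Rightarrow> ('a \<Rightarrow>\<^sub>L 'a)" where
  "sqrt_iter B 0 = 0"
| "sqrt_iter B (Suc n) = (1 / 2) *\<^sub>R (B + (sqrt_iter B n o\<^sub>L sqrt_iter B n))"

lemma sqrt_majorant_bounds: "0 \<le> sqrt_majorant n \<and> sqrt_majorant n \<le> 1"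
  by (induction n) (auto simp: power_le_one)

lemma sqrt_majorant_mono: "sqrt_majorant n \<le> sqrt_majorant (Suc n)"
  using zero_le_power2[of "sqrt_majorant n - 1"] by (simp add: power2_diff)

lemma norm_sqrt_iter_le:
  assumes "norm B \<le> 1"
  shows "norm (sqrt_iter B n) \<le> sqrt_majorant n"
proof (induction n)
  case (Suc n)
  have "norm (B + (sqrt_iter B n o\<^sub>L sqrt_iter B n)) \<le> 1 + sqrt_majorant n * sqrt_majorant n"
    by (intro order_trans[OF norm_triangle_ineq] add_mono assms
        order_trans[OF norm_blinfun_compose] mult_mono Suc)
      (simp_all add: sqrt_majorant_bounds)
  then show ?case
    by (simp add: power2_eq_square)
qed simp

lemma norm_sqrt_iter_diff_le:
  assumes "norm B \<le> 1"
  shows "norm (sqrt_iter B (Suc n) - sqrt_iter B n) \<le> sqrt_majorant (Suc n) - sqrt_majorant n"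
proof (induction n)
  case 0
  then show ?case using assms by simp
next
  case (Suc n)
  let ?X = "sqrt_iter B n" and ?Y = "sqrt_iter B (Suc n)"
  let ?x = "sqrt_majorant n" and ?y = "sqrt_majorant (Suc n)"
  \<comment> \<open>This form of \<open>Y\<^sup>2 - X\<^sup>2 = Y (Y - X) + (Y - X) X\<close> holds for operators that do not commute.\<close>
  have "sqrt_iter B (Suc (Suc n)) - ?Y
      = (1 / 2) *\<^sub>R (B + (?Y o\<^sub>L ?Y)) - (1 / 2) *\<^sub>R (B + (?X o\<^sub>L ?X))"
    by (simp only: sqrt_iter.simps)
  also have "\<dots> = (1 / 2) *\<^sub>R ((?Y o\<^sub>L (?Y - ?X)) + ((?Y - ?X) o\<^sub>L ?X))"
    by (rule blinfun_eqI)
      (simp add: blinfun.add_left blinfun.diff_left blinfun.scaleR_left blinfun.diff_right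
        scaleR_add_right scaleR_diff_right del: sqrt_iter.simps)
  finally have "norm (sqrt_iter B (Suc (Suc n)) - ?Y)
      \<le> (1 / 2) * (?y * (?y - ?x) + (?y - ?x) * ?x)"
    using Suc sqrt_majorant_bounds sqrt_majorant_mono
    by (auto simp del: sqrt_iter.simps sqrt_majorant.simps
        intro!: order_trans[OF norm_triangle_ineq] add_mono
          order_trans[OF norm_blinfun_compose] mult_mono norm_sqrt_iter_le assms)
  also have "\<dots> = (1 + ?y\<^sup>2) / 2 - (1 + ?x\<^sup>2) / 2"
    by (simp add: algebra_simps power2_eq_square diff_divide_distrib del: sqrt_majorant.simps)
  finally show ?case
    by (simp only: sqrt_majorant.simps)
qed

lemma sqrt_iter_converges:
  assumes "norm B \<le> 1"
  obtains L where "sqrt_iter B \<longlonglongrightarrow> L"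
proof -
  have diff: "norm (sqrt_iter B (m + k) - sqrt_iter B m) \<le> sqrt_majorant (m + k) - sqrt_majorant m" for m k
  proof (induction k)
    case (Suc k)
    have "norm (sqrt_iter B (m + Suc k) - sqrt_iter B m)
        \<le> norm (sqrt_iter B (Suc (m + k)) - sqrt_iter B (m + k)) + norm (sqrt_iter B (m + k) - sqrt_iter B m)"
      using norm_triangle_ineq[of "sqrt_iter B (Suc (m + k)) - sqrt_iter B (m + k)"
          "sqrt_iter B (m + k) - sqrt_iter B m"]
      by (simp del: sqrt_iter.simps)
    then show ?case
      using norm_sqrt_iter_diff_le[OF assms, of "m + k"] Suc
      by (simp del: sqrt_iter.simps sqrt_majorant.simps)
  qed simp
  have "incseq sqrt_majorant"
    by (rule incseq_SucI) (rule sqrt_majorant_mono)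
  then have "Cauchy sqrt_majorant"
    using incseq_convergent[of sqrt_majorant 1] sqrt_majorant_bounds LIMSEQ_imp_Cauchy by metis
  have "Cauchy (sqrt_iter B)"
  proof (rule metric_CauchyI)
    fix \<epsilon> :: real assume "\<epsilon> > 0"
    then obtain N where N: "\<And>m n. m \<ge> N \<Longrightarrow> n \<ge> N \<Longrightarrow> dist (sqrt_majorant m) (sqrt_majorant n) < \<epsilon>"
      using \<open>Cauchy sqrt_majorant\<close> by (meson metric_CauchyD)
    have close: "dist (sqrt_iter B n) (sqrt_iter B m) < \<epsilon>" if "m \<ge> N" "n \<ge> m" for m n
      using diff[of m "n - m"] N[of n m] that by (simp add: dist_norm)
    show "\<exists>N. \<forall>m\<ge>N. \<forall>n\<ge>N. dist (sqrt_iter B m) (sqrt_iter B n) < \<epsilon>"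
      using close by (metis dist_commute nle_le)
  qed
  then show thesis
    using that by (meson Cauchy_convergent convergent_def)
qed

text \<open>After scaling to \<open>\<parallel>P\<parallel> = 1\<close>, the operator \<open>B = 1 - P\<close> has norm at most \<open>1\<close>, because
  \<open>\<parallel>P x\<parallel>\<^sup>2 \<le> \<langle>x, P x\<rangle>\<close>. Hence the iteration converges to some \<open>L\<close> with \<open>\<parallel>L\<parallel> \<le> 1\<close>, and \<open>1 - L\<close> is the root.\<close>

lemma positive_sqrt_exists:
  fixes P :: "'a::chilbert \<Rightarrow>\<^sub>L 'a"
  assumes P: "positive_op P"
  obtains R where "positive_op R" "R o\<^sub>L R = P"
proof (cases "P = 0")
  case True
  then show ?thesis using that[of 0] P by simp
next
  case False
  define T where "T = (1 / norm P) *\<^sub>R P"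
  have T: "positive_op T" "norm T = 1"
    using False P by (simp_all add: T_def positive_op_iff blinfun.scaleR_left
        bounded_bilinear.scaleR_right[OF bounded_bilinear_cinner])
  define B where "B = id_blinfun - T"
  have "norm B \<le> 1"
  proof (rule norm_blinfun_bound)
    fix x :: 'a
    have "(norm (blinfun_apply B x))\<^sup>2 = (norm x)\<^sup>2 - 2 * Re (cinner x (blinfun_apply T x)) + (norm (blinfun_apply T x))\<^sup>2"
      using norm_add_squared[of x "- blinfun_apply T x"]
      by (simp add: B_def blinfun.diff_left)
    also have "\<dots> \<le> (norm x)\<^sup>2"
    proof -
      have "0 \<le> Re (cinner x (blinfun_apply T x))"
        using T by (simp add: positive_op_iff)
      then show ?thesis
        using positive_op_norm_squared_le[OF T(1), of x] T(2) by simp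
    qed
    finally have "norm (blinfun_apply B x) \<le> norm x"
      by (rule power2_le_imp_le) simp
    then show "norm (blinfun_apply B x) \<le> 1 * norm x" by simp
  qed simp
  then obtain L where L: "sqrt_iter B \<longlonglongrightarrow> L"
    by (rule sqrt_iter_converges)
  have B: "B \<in> bounded_ops" "\<And>x y. cinner (blinfun_apply B x) y = cinner x (blinfun_apply B y)"
    using T by (simp_all add: B_def blinfun.diff_left cinner_diff_left cinner_diff_right positive_op_symmetric)
  have iter: "sqrt_iter B n \<in> bounded_ops \<and>
      (\<forall>x y. cinner (blinfun_apply (sqrt_iter B n) x) y = cinner x (blinfun_apply (sqrt_iter B n) y))" for n
  proof (induction n)
    case (Suc n)
    then have X: "sqrt_iter B n \<in> bounded_ops"
      "\<And>x y. cinner (blinfun_apply (sqrt_iter B n) x) y = cinner x (blinfun_apply (sqrt_iter B n) y)"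
      by blast+
    have "sqrt_iter B (Suc n) \<in> bounded_ops"
      using X(1) B(1) by simp
    moreover have "cinner (blinfun_apply (sqrt_iter B (Suc n)) x) y
        = cinner x (blinfun_apply (sqrt_iter B (Suc n)) y)" for x y
      by (simp add: B(2) X(2) blinfun.add_left blinfun.scaleR_left cinner_add_left cinner_add_right
          bounded_bilinear.scaleR_right[OF bounded_bilinear_cinner]
          bounded_bilinear.scaleR_left[OF bounded_bilinear_cinner])
    ultimately show ?case by blast
  qed simp
  have L_bounded: "L \<in> bounded_ops"
    using closed_sequentially[OF closed_bounded_ops _ L] iter by blast
  have L_apply: "(\<lambda>n. blinfun_apply (sqrt_iter B n) x) \<longlonglongrightarrow> blinfun_apply L x" for x
    by (intro tendsto_intros L)
  have L_sym: "cinner (blinfun_apply L x) y = cinner x (blinfun_apply L y)" for x y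
  proof (rule LIMSEQ_unique)
    show "(\<lambda>n. cinner (blinfun_apply (sqrt_iter B n) x) y) \<longlonglongrightarrow> cinner (blinfun_apply L x) y"
      by (intro bounded_bilinear.tendsto[OF bounded_bilinear_cinner] L_apply tendsto_const)
    show "(\<lambda>n. cinner (blinfun_apply (sqrt_iter B n) x) y) \<longlonglongrightarrow> cinner x (blinfun_apply L y)"
      using iter by (simp, intro bounded_bilinear.tendsto[OF bounded_bilinear_cinner] L_apply tendsto_const)
  qed
  have L_norm: "norm L \<le> 1"
  proof (rule LIMSEQ_le_const2[OF tendsto_norm[OF L]])
    have "norm (sqrt_iter B n) \<le> 1" for n
      using norm_sqrt_iter_le[OF \<open>norm B \<le> 1\<close>, of n] sqrt_majorant_bounds[of n] by linarith
    then show "\<exists>N. \<forall>n\<ge>N. norm (sqrt_iter B n) \<le> 1" by blast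
  qed
  have L_fixed: "L = (1 / 2) *\<^sub>R (B + (L o\<^sub>L L))"
  proof (rule LIMSEQ_unique)
    show "(\<lambda>n. sqrt_iter B (Suc n)) \<longlonglongrightarrow> L"
      by (rule LIMSEQ_Suc[OF L])
    show "(\<lambda>n. sqrt_iter B (Suc n)) \<longlonglongrightarrow> (1 / 2) *\<^sub>R (B + (L o\<^sub>L L))"
      unfolding sqrt_iter.simps
      by (intro tendsto_intros bounded_bilinear.tendsto[OF bounded_bilinear_blinfun_compose] L)
  qed
  define R where "R = id_blinfun - L"
  have "positive_op R"
  proof (rule positive_opI)
    show "Re (cinner x (blinfun_apply R x)) \<ge> 0" for x
    proof -
      have "Re (cinner x (blinfun_apply L x)) \<le> norm L * norm x * norm x"
        by (rule Re_cinner_le_norm)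
      also have "\<dots> \<le> 1 * norm x * norm x"
        by (intro mult_right_mono L_norm) simp_all
      finally show ?thesis
        by (simp add: R_def blinfun.diff_left cinner_diff_right cinner_self power2_eq_square)
    qed
  qed (simp_all add: R_def L_bounded blinfun.diff_left cinner_diff_left cinner_diff_right L_sym)
  have RR: "R o\<^sub>L R = T"
  proof (rule blinfun_eqI)
    fix x
    have "blinfun_apply L x = (1 / 2) *\<^sub>R (blinfun_apply B x + blinfun_apply L (blinfun_apply L x))"
      using arg_cong[OF L_fixed, of "\<lambda>A. blinfun_apply A x"]
      by (simp add: blinfun.add_left blinfun.scaleR_left)
    then have "2 *\<^sub>R blinfun_apply L x = blinfun_apply B x + blinfun_apply L (blinfun_apply L x)"
      by (metis (no_types) divide_self_if mult.commute scaleR_one scaleR_scaleR times_divide_eq_left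
          mult_1 zero_neq_numeral)
    then show "blinfun_apply (R o\<^sub>L R) x = blinfun_apply T x"
      by (simp add: R_def B_def blinfun.diff_left blinfun.diff_right scaleR_2 algebra_simps)
  qed
  define Q where "Q = sqrt (norm P) *\<^sub>R R"
  have "positive_op Q"
    using \<open>positive_op R\<close> by (simp add: Q_def positive_op_iff blinfun.scaleR_left
        bounded_bilinear.scaleR_right[OF bounded_bilinear_cinner])
  moreover have "Q o\<^sub>L Q = P"
  proof (rule blinfun_eqI)
    fix x
    show "blinfun_apply (Q o\<^sub>L Q) x = blinfun_apply P x"
      using arg_cong[OF RR, of "\<lambda>A. blinfun_apply A x"] False
      by (simp add: Q_def T_def blinfun.scaleR_left blinfun.scaleR_right)
  qed
  ultimately show ?thesis by (rule that)
qed

section \<open>Hilbert--Schmidt operators\<close>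

definition trace_basis :: "'a::chilbert set" where
  "trace_basis = (SOME E. orthonormal_basis E)"

lemma orthonormal_basis_trace_basis [simp]: "orthonormal_basis trace_basis"
  unfolding trace_basis_def using orthonormal_basis_exists by (rule someI_ex)

lemma trace_op_eqI:
  "((\<lambda>e. cinner e (blinfun_apply T e)) has_sum t) trace_basis \<Longrightarrow> trace_op T = t"
  unfolding trace_op_def trace_basis_def[symmetric] by (rule infsumI)

text \<open>Both sides equal the sum of \<open>|\<langle>f, X e\<rangle>|\<^sup>2\<close> over all pairs \<open>(e, f)\<close>, by Parseval's
  identity in either variable. For \<open>E \<noteq> F\<close> it is the reason why traces do not depend on the basis.\<close>

lemma has_sum_norm_squared_adj:
  assumes E: "orthonormal_basis E" and F: "orthonormal_basis F" and X: "X \<in> bounded_ops"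
    and sum: "((\<lambda>e. (norm (blinfun_apply X e))\<^sup>2) has_sum s) E"
  shows "((\<lambda>f. (norm (blinfun_apply (adj X) f))\<^sup>2) has_sum s) F"
proof -
  define g where "g p = (cmod (cinner (snd p) (blinfun_apply X (fst p))))\<^sup>2" for p
  have row: "((\<lambda>f. g (e, f)) has_sum (norm (blinfun_apply X e))\<^sup>2) F" for e
    unfolding g_def fst_conv snd_conv by (rule Parseval_norm[OF F])
  have col: "((\<lambda>e. g (e, f)) has_sum (norm (blinfun_apply (adj X) f))\<^sup>2) E" for f
  proof -
    have "cmod (cinner e (blinfun_apply (adj X) f)) = cmod (cinner f (blinfun_apply X e))" for e
      unfolding cinner_adj_right[OF X] by (subst cinner_commute) (rule complex_mod_cnj)
    then show ?thesis
      using Parseval_norm[OF E, of "blinfun_apply (adj X) f"] by (simp add: g_def)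
  qed
  have "g summable_on E \<times> F"
    by (rule summable_on_SigmaI[OF row]) (use sum in \<open>auto simp: g_def has_sum_imp_summable\<close>)
  then have "(g has_sum s) (E \<times> F)"
    by (rule has_sum_SigmaI[OF row sum])
  then have "((\<lambda>(f, e). g (e, f)) has_sum s) (F \<times> E)"
    by (rule iffD1[OF has_sum_swap])
  then show ?thesis
    by (rule has_sum_SigmaD) (simp add: col)
qed

definition hilbert_schmidt :: "('a::chilbert \<Rightarrow>\<^sub>L 'a) \<Rightarrow> bool" where
  "hilbert_schmidt X \<longleftrightarrow>
     X \<in> bounded_ops \<and> (\<lambda>e. (norm (blinfun_apply X e))\<^sup>2) summable_on trace_basis"

lemma hilbert_schmidt_bounded [intro, simp]: "hilbert_schmidt X \<Longrightarrow> X \<in> bounded_ops"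
  by (simp add: hilbert_schmidt_def)

lemma hilbert_schmidt_adj: "hilbert_schmidt X \<Longrightarrow> hilbert_schmidt (adj X)"
  unfolding hilbert_schmidt_def
  by (metis adj_bounded_ops has_sum_norm_squared_adj orthonormal_basis_trace_basis summable_on_def)

lemma hilbert_schmidt_compose_left:
  assumes A: "A \<in> bounded_ops" and X: "hilbert_schmidt X"
  shows "hilbert_schmidt (A o\<^sub>L X)"
  unfolding hilbert_schmidt_def
proof
  show "(\<lambda>e. (norm (blinfun_apply (A o\<^sub>L X) e))\<^sup>2) summable_on trace_basis"
  proof (rule summable_on_comparison_test)
    show "(\<lambda>e. (norm A)\<^sup>2 * (norm (blinfun_apply X e))\<^sup>2) summable_on trace_basis"
      using X by (intro summable_on_cmult_right) (simp add: hilbert_schmidt_def)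
    show "(norm (blinfun_apply (A o\<^sub>L X) e))\<^sup>2 \<le> (norm A)\<^sup>2 * (norm (blinfun_apply X e))\<^sup>2" for e
      using power_mono[OF norm_blinfun[of A "blinfun_apply X e"], of 2] by (simp add: power_mult_distrib)
  qed simp
qed (use assms in simp)

lemma hilbert_schmidt_compose_right:
  assumes A: "A \<in> bounded_ops" and X: "hilbert_schmidt X"
  shows "hilbert_schmidt (X o\<^sub>L A)"
proof -
  have "hilbert_schmidt (adj (adj A o\<^sub>L adj X))"
    using assms by (intro hilbert_schmidt_adj hilbert_schmidt_compose_left) simp_all
  then show ?thesis
    using assms by (simp add: adj_compose)
qed

lemma hilbert_schmidt_add_scale:
  assumes X: "hilbert_schmidt X" and Y: "hilbert_schmidt Y"
  shows "hilbert_schmidt (X + scale_op c Y)"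
  unfolding hilbert_schmidt_def
proof
  show "(\<lambda>e. (norm (blinfun_apply (X + scale_op c Y) e))\<^sup>2) summable_on trace_basis"
  proof (rule summable_on_comparison_test)
    show "(\<lambda>e. 2 * (norm (blinfun_apply X e))\<^sup>2 + 2 * (cmod c)\<^sup>2 * (norm (blinfun_apply Y e))\<^sup>2)
        summable_on trace_basis"
      using X Y by (intro summable_on_add summable_on_cmult_right) (simp_all add: hilbert_schmidt_def)
    fix e :: 'a
    define a b where "a = norm (blinfun_apply X e)" and "b = cmod c * norm (blinfun_apply Y e)"
    have "norm (blinfun_apply (X + scale_op c Y) e) \<le> a + b"
      unfolding a_def b_def norm_scaleC[symmetric] by (simp add: blinfun.add_left norm_triangle_ineq)
    then have "(norm (blinfun_apply (X + scale_op c Y) e))\<^sup>2 \<le> (a + b)\<^sup>2"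
      by (intro power_mono) simp_all
    also have "\<dots> \<le> 2 * a\<^sup>2 + 2 * b\<^sup>2"
      using zero_le_power2[of "a - b"] unfolding power2_sum power2_diff by linarith
    finally show "(norm (blinfun_apply (X + scale_op c Y) e))\<^sup>2
        \<le> 2 * (norm (blinfun_apply X e))\<^sup>2 + 2 * (cmod c)\<^sup>2 * (norm (blinfun_apply Y e))\<^sup>2"
      unfolding a_def b_def power_mult_distrib mult.assoc .
  qed (rule zero_le_power2)
  show "X + scale_op c Y \<in> bounded_ops"
    using X Y by (intro bounded_ops_closure hilbert_schmidt_bounded)
qed

lemma has_sum_diff:
  fixes f g :: "'i \<Rightarrow> 'b::real_normed_vector"
  assumes "(f has_sum a) A" "(g has_sum b) A"
  shows "((\<lambda>x. f x - g x) has_sum (a - b)) A"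
  using has_sum_add[OF assms(1) has_sum_bounded_linear[OF bounded_linear_minus[OF bounded_linear_ident] assms(2)]]
  by simp

lemma cinner_polarization:
  "cinner a b = complex_of_real ((norm (a + 1 *\<^sub>C b))\<^sup>2) / 4
      - complex_of_real ((norm (a + (-1) *\<^sub>C b))\<^sup>2) / 4
      - \<i> * complex_of_real ((norm (a + \<i> *\<^sub>C b))\<^sup>2) / 4
      + \<i> * complex_of_real ((norm (a + (-\<i>) *\<^sub>C (b :: 'a::chilbert)))\<^sup>2) / 4"
  unfolding norm_add_squared norm_scaleC cinner_scaleC_right
  by (simp add: complex_eq_iff field_simps del: scaleC_one)

text \<open>Polarization extends the invariance of \<open>\<Sum>\<^sub>e \<parallel>Z e\<parallel>\<^sup>2\<close> under taking adjoints, applied to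
  \<open>Z = X + c Y\<close>, to the Hilbert--Schmidt inner product.\<close>

lemma has_sum_cinner_adj:
  assumes X: "hilbert_schmidt X" and Y: "hilbert_schmidt Y"
  obtains t where "((\<lambda>e. cinner (blinfun_apply X e) (blinfun_apply Y e)) has_sum t) trace_basis"
    and "((\<lambda>e. cinner (blinfun_apply (adj Y) e) (blinfun_apply (adj X) e)) has_sum t) trace_basis"
proof -
  define Z where "Z c = X + scale_op c Y" for c
  define S where "S c = infsum (\<lambda>e. (norm (blinfun_apply (Z c) e))\<^sup>2) trace_basis" for c
  have Z: "hilbert_schmidt (Z c)" for c
    unfolding Z_def by (rule hilbert_schmidt_add_scale[OF X Y])
  then have sum: "((\<lambda>e. (norm (blinfun_apply (Z c) e))\<^sup>2) has_sum S c) trace_basis" for c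
    by (simp add: S_def hilbert_schmidt_def)
  then have adj_sum: "((\<lambda>e. (norm (blinfun_apply (adj (Z c)) e))\<^sup>2) has_sum S c) trace_basis" for c
    by (rule has_sum_norm_squared_adj[rotated 3]) (use Z in simp_all)
  have sum': "((\<lambda>e. complex_of_real ((norm (blinfun_apply X e + c *\<^sub>C blinfun_apply Y e))\<^sup>2))
      has_sum complex_of_real (S c)) trace_basis" for c
    using has_sum_of_real[OF sum[of c]] by (simp add: Z_def blinfun.add_left)
  have adj_sum': "((\<lambda>e. complex_of_real ((norm (blinfun_apply (adj Y) e + c *\<^sub>C blinfun_apply (adj X) e))\<^sup>2))
      has_sum complex_of_real (S c)) trace_basis" if c: "cnj c * c = 1" for c
  proof -
    have "cmod c = 1"
      using c by (simp add: cnj_mult_self) (metis norm_ge_zero power2_eq_1_iff of_real_1 of_real_eq_iff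
          of_real_power le_minus_one_simps(3))
    have "norm (blinfun_apply (adj (Z c)) e)
        = norm (blinfun_apply (adj Y) e + c *\<^sub>C blinfun_apply (adj X) e)" for e
    proof -
      have "blinfun_apply (adj (Z c)) e
          = blinfun_apply (adj X) e + cnj c *\<^sub>C blinfun_apply (adj Y) e"
        using X Y by (simp add: Z_def adj_add adj_scale_op blinfun.add_left)
      also have "\<dots> = cnj c *\<^sub>C (blinfun_apply (adj Y) e + c *\<^sub>C blinfun_apply (adj X) e)"
        by (simp add: scaleC_add_right scaleC_scaleC c add.commute)
      finally show ?thesis
        using \<open>cmod c = 1\<close> by (simp add: norm_scaleC)
    qed
    then show ?thesis
      using has_sum_of_real[OF adj_sum[of c]] by simp
  qed
  define t where "t = complex_of_real (S 1) / 4 - complex_of_real (S (-1)) / 4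
      - \<i> * complex_of_real (S \<i>) / 4 + \<i> * complex_of_real (S (-\<i>)) / 4"
  have combine: "((\<lambda>e. p 1 e / 4 - p (-1) e / 4 - \<i> * p \<i> e / 4 + \<i> * p (-\<i>) e / 4) has_sum t) trace_basis"
    if "\<And>c. cnj c * c = 1 \<Longrightarrow> (p c has_sum complex_of_real (S c)) trace_basis" for p :: "complex \<Rightarrow> 'a \<Rightarrow> complex"
    unfolding t_def
    by (intro has_sum_add has_sum_diff has_sum_divide_const has_sum_cmult_right that) simp_all
  show thesis
  proof
    show "((\<lambda>e. cinner (blinfun_apply X e) (blinfun_apply Y e)) has_sum t) trace_basis"
      by (subst cinner_polarization) (rule combine, rule sum')
    show "((\<lambda>e. cinner (blinfun_apply (adj Y) e) (blinfun_apply (adj X) e)) has_sum t) trace_basis"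
      by (subst cinner_polarization) (rule combine, rule adj_sum')
  qed
qed

section \<open>The trace on positive operators and their linear span\<close>

lemma cinner_positive_sqrt:
  assumes "positive_op R"
  shows "cinner x (blinfun_apply (R o\<^sub>L R) x) = complex_of_real ((norm (blinfun_apply R x))\<^sup>2)"
  by (simp add: cinner_self flip: positive_op_symmetric[OF assms])

text \<open>The basis in the definition of the trace class is arbitrary; that in the definition of the trace
  is a fixed one. Since \<open>R\<close> is its own adjoint, the sum \<open>\<Sum>\<^sub>e \<parallel>R e\<parallel>\<^sup>2\<close> does not depend on the basis.\<close>

lemma positive_trace_class_iff:
  fixes R :: "'a::chilbert \<Rightarrow>\<^sub>L 'a"
  assumes R: "positive_op R"
  shows "R o\<^sub>L R \<in> trace_class \<longleftrightarrow> hilbert_schmidt R"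
proof -
  have "positive_op (R o\<^sub>L R)"
    using cinner_positive_sqrt[OF R] R by (simp add: positive_op_iff del: blinfun_apply_blinfun_compose)
  then have abs: "abs_op (R o\<^sub>L R) = R o\<^sub>L R"
    by (rule abs_op_positive)
  have summable: "(\<lambda>e. cinner e (blinfun_apply (R o\<^sub>L R) e)) summable_on E
      \<longleftrightarrow> (\<lambda>e. (norm (blinfun_apply R e))\<^sup>2) summable_on E" for E
    unfolding cinner_positive_sqrt[OF R]
    using summable_on_of_real[of "\<lambda>e. (norm (blinfun_apply R e))\<^sup>2" E, where ?'a = complex]
      summable_on_Re[of "\<lambda>e. complex_of_real ((norm (blinfun_apply R e))\<^sup>2)" E]
    by (simp only: Re_complex_of_real) blast
  show ?thesis
  proof
    assume "R o\<^sub>L R \<in> trace_class"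
    then obtain E where E: "orthonormal_basis E" "(\<lambda>e. (norm (blinfun_apply R e))\<^sup>2) summable_on E"
      unfolding trace_class_def mem_Collect_eq abs summable by blast
    then obtain s where "((\<lambda>e. (norm (blinfun_apply R e))\<^sup>2) has_sum s) E"
      by (auto simp: summable_on_def)
    then have "((\<lambda>e. (norm (blinfun_apply (adj R) e))\<^sup>2) has_sum s) trace_basis"
      using R by (intro has_sum_norm_squared_adj[OF E(1)]) simp_all
    then show "hilbert_schmidt R"
      using R by (auto simp: hilbert_schmidt_def adj_positive summable_on_def)
  next
    assume "hilbert_schmidt R"
    then show "R o\<^sub>L R \<in> trace_class"
      unfolding trace_class_def hilbert_schmidt_def abs mem_Collect_eq summable
      by (metis bounded_ops_closure(5) orthonormal_basis_trace_basis)
  qed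
qed

lemma positive_trace_class_cases:
  assumes "positive_op P" "P \<in> trace_class"
  obtains R where "positive_op R" "hilbert_schmidt R" "P = R o\<^sub>L R"
  using assms positive_sqrt_exists positive_trace_class_iff by metis

lemma positive_trace_classI:
  assumes P: "positive_op P"
    and sum: "(\<lambda>e. Re (cinner e (blinfun_apply P e))) summable_on trace_basis"
  shows "P \<in> trace_class"
proof -
  obtain R where R: "positive_op R" "P = R o\<^sub>L R"
    using positive_sqrt_exists[OF P] by metis
  have "hilbert_schmidt R"
    using sum R by (simp add: hilbert_schmidt_def cinner_positive_sqrt del: blinfun_apply_blinfun_compose)
  then show ?thesis
    unfolding R(2) by (rule positive_trace_class_iff[OF R(1), THEN iffD2])
qed

text \<open>The identity \<open>tr (B T A) = tr (T A B)\<close>, including the existence of both traces. It is a linear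
  condition on \<open>T\<close>, so that it passes from positive trace class operators to their linear span.\<close>

definition traceable :: "('a::chilbert \<Rightarrow>\<^sub>L 'a) \<Rightarrow> bool" where
  "traceable T \<longleftrightarrow> T \<in> bounded_ops \<and> (\<forall>A\<in>bounded_ops. \<forall>B\<in>bounded_ops. \<exists>t.
     ((\<lambda>e. cinner e (blinfun_apply B (blinfun_apply T (blinfun_apply A e)))) has_sum t) trace_basis \<and>
     ((\<lambda>e. cinner e (blinfun_apply T (blinfun_apply A (blinfun_apply B e)))) has_sum t) trace_basis)"

text \<open>With \<open>P = R\<^sup>2\<close>, both \<open>tr (B P A)\<close> and \<open>tr (P A B)\<close> are Hilbert--Schmidt inner products, of
  \<open>R B\<^sup>*\<close> with \<open>R A\<close> and of \<open>R\<close> with \<open>R A B\<close>; passing to adjoints turns both into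
  \<open>\<Sum>\<^sub>f \<langle>R f, A B R f\<rangle>\<close>.\<close>

lemma positive_sqrt_cyclic:
  assumes R: "positive_op R" "hilbert_schmidt R" and A: "A \<in> bounded_ops" and B: "B \<in> bounded_ops"
  obtains t where
    "((\<lambda>e. cinner e (blinfun_apply B (blinfun_apply (R o\<^sub>L R) (blinfun_apply A e)))) has_sum t) trace_basis"
    "((\<lambda>e. cinner (blinfun_apply R e) (blinfun_apply A (blinfun_apply B (blinfun_apply R e)))) has_sum t) trace_basis"
proof -
  have hs: "hilbert_schmidt (R o\<^sub>L adj B)" "hilbert_schmidt (R o\<^sub>L A)"
    using R A B by (simp_all add: hilbert_schmidt_compose_right)
  obtain t where t:
    "((\<lambda>e. cinner (blinfun_apply (R o\<^sub>L adj B) e) (blinfun_apply (R o\<^sub>L A) e)) has_sum t) trace_basis"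
    "((\<lambda>e. cinner (blinfun_apply (adj (R o\<^sub>L A)) e) (blinfun_apply (adj (R o\<^sub>L adj B)) e)) has_sum t) trace_basis"
    by (rule has_sum_cinner_adj[OF hs])
  have "cinner (blinfun_apply (R o\<^sub>L adj B) e) (blinfun_apply (R o\<^sub>L A) e)
      = cinner e (blinfun_apply B (blinfun_apply (R o\<^sub>L R) (blinfun_apply A e)))" for e
    by (simp add: positive_op_symmetric[OF R(1)] cinner_adj_left[OF B])
  moreover have "cinner (blinfun_apply (adj (R o\<^sub>L A)) e) (blinfun_apply (adj (R o\<^sub>L adj B)) e)
      = cinner (blinfun_apply R e) (blinfun_apply A (blinfun_apply B (blinfun_apply R e)))" for e
    using R A B by (simp add: adj_compose adj_positive cinner_adj_left)
  ultimately show thesis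
    using that t by simp
qed

lemma traceable_positive:
  assumes "positive_op P" "P \<in> trace_class"
  shows "traceable P"
  unfolding traceable_def
proof (intro conjI ballI)
  obtain R where R: "positive_op R" "hilbert_schmidt R" "P = R o\<^sub>L R"
    using assms by (rule positive_trace_class_cases)
  fix A B :: "'a \<Rightarrow>\<^sub>L 'a"
  assume AB: "A \<in> bounded_ops" "B \<in> bounded_ops"
  obtain t where t:
    "((\<lambda>e. cinner e (blinfun_apply B (blinfun_apply P (blinfun_apply A e)))) has_sum t) trace_basis"
    "((\<lambda>e. cinner (blinfun_apply R e) (blinfun_apply A (blinfun_apply B (blinfun_apply R e)))) has_sum t) trace_basis"
    using positive_sqrt_cyclic[OF R(1,2) AB] R(3) by blast
  obtain t' where t':
    "((\<lambda>e. cinner e (blinfun_apply P (blinfun_apply A (blinfun_apply B e)))) has_sum t') trace_basis"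
    "((\<lambda>e. cinner (blinfun_apply R e) (blinfun_apply A (blinfun_apply B (blinfun_apply R e)))) has_sum t') trace_basis"
    using positive_sqrt_cyclic[OF R(1,2) bounded_ops_closure(5)[OF AB] id_in_bounded_ops] R(3) by auto
  have "t = t'"
    using t(2) t'(2) by (rule has_sum_unique)
  then show "\<exists>t. ((\<lambda>e. cinner e (blinfun_apply B (blinfun_apply P (blinfun_apply A e)))) has_sum t) trace_basis \<and>
     ((\<lambda>e. cinner e (blinfun_apply P (blinfun_apply A (blinfun_apply B e)))) has_sum t) trace_basis"
    using t(1) t'(1) by blast
qed (use assms in simp)

lemma traceable_add: 
  assumes "traceable S" "traceable T"
  shows "traceable (S + T)"
  unfolding traceable_def
proof (intro conjI ballI)
  fix A B :: "'a \<Rightarrow>\<^sub>L 'a"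
  assume AB: "A \<in> bounded_ops" "B \<in> bounded_ops"
  obtain s where s:
    "((\<lambda>e. cinner e (blinfun_apply B (blinfun_apply S (blinfun_apply A e)))) has_sum s) trace_basis"
    "((\<lambda>e. cinner e (blinfun_apply S (blinfun_apply A (blinfun_apply B e)))) has_sum s) trace_basis"
    using assms(1) AB unfolding traceable_def by blast
  obtain t where t:
    "((\<lambda>e. cinner e (blinfun_apply B (blinfun_apply T (blinfun_apply A e)))) has_sum t) trace_basis"
    "((\<lambda>e. cinner e (blinfun_apply T (blinfun_apply A (blinfun_apply B e)))) has_sum t) trace_basis"
    using assms(2) AB unfolding traceable_def by blast
  show "\<exists>t. ((\<lambda>e. cinner e (blinfun_apply B (blinfun_apply (S + T) (blinfun_apply A e)))) has_sum t) trace_basis \<and>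
     ((\<lambda>e. cinner e (blinfun_apply (S + T) (blinfun_apply A (blinfun_apply B e)))) has_sum t) trace_basis"
    using has_sum_add[OF s(1) t(1)] has_sum_add[OF s(2) t(2)]
    by (auto simp: blinfun.add_left blinfun.add_right cinner_add_right)
qed (use assms in \<open>simp add: traceable_def\<close>)

lemma traceable_scale_op:
  assumes "traceable T"
  shows "traceable (scale_op c T)"
  unfolding traceable_def
proof (intro conjI ballI)
  fix A B :: "'a \<Rightarrow>\<^sub>L 'a"
  assume AB: "A \<in> bounded_ops" "B \<in> bounded_ops"
  obtain t where t:
    "((\<lambda>e. cinner e (blinfun_apply B (blinfun_apply T (blinfun_apply A e)))) has_sum t) trace_basis"
    "((\<lambda>e. cinner e (blinfun_apply T (blinfun_apply A (blinfun_apply B e)))) has_sum t) trace_basis"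
    using assms AB unfolding traceable_def by blast
  show "\<exists>t. ((\<lambda>e. cinner e (blinfun_apply B (blinfun_apply (scale_op c T) (blinfun_apply A e)))) has_sum t) trace_basis \<and>
     ((\<lambda>e. cinner e (blinfun_apply (scale_op c T) (blinfun_apply A (blinfun_apply B e)))) has_sum t) trace_basis"
    using has_sum_cmult_right[OF t(1), of c] has_sum_cmult_right[OF t(2), of c]
    by (auto simp: bounded_opsD[OF AB(2)] cinner_scaleC_right)
qed (use assms in \<open>simp add: traceable_def\<close>)

lemma traceable_has_sum:
  assumes "traceable T" "A \<in> bounded_ops" "B \<in> bounded_ops"
  shows "((\<lambda>e. cinner e (blinfun_apply B (blinfun_apply T (blinfun_apply A e))))
    has_sum trace_op (T o\<^sub>L (A o\<^sub>L B))) trace_basis"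
proof -
  obtain t where t:
    "((\<lambda>e. cinner e (blinfun_apply B (blinfun_apply T (blinfun_apply A e)))) has_sum t) trace_basis"
    "((\<lambda>e. cinner e (blinfun_apply T (blinfun_apply A (blinfun_apply B e)))) has_sum t) trace_basis"
    using assms unfolding traceable_def by blast
  have "trace_op (T o\<^sub>L (A o\<^sub>L B)) = t"
    by (rule trace_op_eqI) (use t(2) in simp)
  then show ?thesis using t(1) by simp
qed

lemma compose_id [simp]: "A o\<^sub>L id_blinfun = A" "id_blinfun o\<^sub>L A = A"
  by (rule blinfun_eqI, simp)+

lemma trace_op_commute:
  assumes "traceable T" "A \<in> bounded_ops"
  shows "trace_op (A o\<^sub>L T) = trace_op (T o\<^sub>L A)"
  using trace_op_eqI[of "A o\<^sub>L T"] traceable_has_sum[OF assms(1) id_in_bounded_ops assms(2)]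
  by simp

lemma trace_op_compose_add:
  assumes "traceable S" "traceable T" "A \<in> bounded_ops"
  shows "trace_op ((S + T) o\<^sub>L A) = trace_op (S o\<^sub>L A) + trace_op (T o\<^sub>L A)"
  using has_sum_add[OF traceable_has_sum[OF assms(1,3) id_in_bounded_ops]
      traceable_has_sum[OF assms(2,3) id_in_bounded_ops]]
  by (intro trace_op_eqI) (simp add: blinfun.add_left cinner_add_right)

lemma trace_op_compose_scale:
  assumes "traceable T" "A \<in> bounded_ops"
  shows "trace_op (scale_op c T o\<^sub>L A) = c * trace_op (T o\<^sub>L A)"
  using has_sum_cmult_right[OF traceable_has_sum[OF assms id_in_bounded_ops], of c]
  by (intro trace_op_eqI) (simp add: cinner_scaleC_right)

lemma positive_sqrt_trace:
  assumes R: "positive_op R" "hilbert_schmidt R" and A: "A \<in> bounded_ops"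
  shows "((\<lambda>e. cinner (blinfun_apply R e) (blinfun_apply A (blinfun_apply R e)))
    has_sum trace_op (R o\<^sub>L R o\<^sub>L A)) trace_basis"
proof -
  obtain t where t:
    "((\<lambda>e. cinner e (blinfun_apply id_blinfun (blinfun_apply (R o\<^sub>L R) (blinfun_apply A e)))) has_sum t) trace_basis"
    "((\<lambda>e. cinner (blinfun_apply R e) (blinfun_apply A (blinfun_apply id_blinfun (blinfun_apply R e)))) has_sum t) trace_basis"
    by (rule positive_sqrt_cyclic[OF R A id_in_bounded_ops])
  have "trace_op (R o\<^sub>L R o\<^sub>L A) = t"
    by (rule trace_op_eqI) (use t(1) in simp)
  then show ?thesis using t(2) by simp
qed

lemma positive_sqrt_trace_norm:
  assumes R: "positive_op R" "hilbert_schmidt R"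
  shows "((\<lambda>e. (norm (blinfun_apply R e))\<^sup>2) has_sum Re (trace_op (R o\<^sub>L R))) trace_basis"
  using has_sum_Re[OF positive_sqrt_trace[OF R id_in_bounded_ops]] by (simp add: cinner_self)

lemma norm_trace_op_positive_le:
  assumes P: "positive_op P" "P \<in> trace_class" and A: "A \<in> bounded_ops"
  shows "cmod (trace_op (P o\<^sub>L A)) \<le> norm A * Re (trace_op P)"
proof -
  obtain R where R: "positive_op R" "hilbert_schmidt R" and P_eq: "P = R o\<^sub>L R"
    using P by (rule positive_trace_class_cases)
  show ?thesis
    unfolding P_eq
  proof (rule norm_infsum_le[OF positive_sqrt_trace[OF R A]])
    show "((\<lambda>e. norm A * (norm (blinfun_apply R e))\<^sup>2) has_sum norm A * Re (trace_op (R o\<^sub>L R))) trace_basis"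
      by (rule has_sum_cmult_right[OF positive_sqrt_trace_norm[OF R]])
    fix e
    let ?y = "blinfun_apply R e"
    have "cmod (cinner ?y (blinfun_apply A ?y)) \<le> norm ?y * norm (blinfun_apply A ?y)"
      by (rule cinner_Cauchy_Schwarz)
    also have "\<dots> \<le> norm ?y * (norm A * norm ?y)"
      by (intro mult_left_mono norm_blinfun) simp
    finally show "cmod (cinner ?y (blinfun_apply A ?y)) \<le> norm A * (norm ?y)\<^sup>2"
      by (simp add: power2_eq_square mult_ac)
  qed
qed

lemma positive_form_le_trace:
  assumes P: "positive_op P" "P \<in> trace_class"
  shows "Re (cinner u (blinfun_apply P u)) \<le> Re (trace_op P) * (norm u)\<^sup>2"
proof -
  obtain R where R: "positive_op R" "hilbert_schmidt R" and P_eq: "P = R o\<^sub>L R"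
    using P by (rule positive_trace_class_cases)
  have "Re (cinner u (blinfun_apply P u)) = (norm (blinfun_apply R u))\<^sup>2"
    unfolding P_eq cinner_positive_sqrt[OF R(1)] by (rule Re_complex_of_real)
  also have "\<dots> \<le> Re (trace_op P) * (norm u)\<^sup>2"
  proof (rule has_sum_mono[OF Parseval_norm[OF orthonormal_basis_trace_basis]])
    show "((\<lambda>e. (norm (blinfun_apply R e))\<^sup>2 * (norm u)\<^sup>2) has_sum Re (trace_op P) * (norm u)\<^sup>2) trace_basis"
      unfolding P_eq by (rule has_sum_cmult_left[OF positive_sqrt_trace_norm[OF R]])
    fix e
    have "cmod (cinner e (blinfun_apply R u)) \<le> norm (blinfun_apply R e) * norm u"
      using cinner_Cauchy_Schwarz[of "blinfun_apply R e" u] by (simp add: positive_op_symmetric[OF R(1)])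
    then have "(cmod (cinner e (blinfun_apply R u)))\<^sup>2 \<le> (norm (blinfun_apply R e) * norm u)\<^sup>2"
      by (rule power_mono) simp
    then show "(cmod (cinner e (blinfun_apply R u)))\<^sup>2 \<le> (norm (blinfun_apply R e))\<^sup>2 * (norm u)\<^sup>2"
      by (simp only: power_mult_distrib)
  qed
  finally show ?thesis .
qed

section \<open>Rank-one operators\<close>

lift_definition rank_one :: "'a::chilbert \<Rightarrow> 'a \<Rightarrow> ('a \<Rightarrow>\<^sub>L 'a)"
  is "\<lambda>x y z. cinner y z *\<^sub>C x"
proof (rule bounded_linear_intro)
  fix x y z :: 'a
  show "norm (cinner y z *\<^sub>C x) \<le> norm z * (norm y * norm x)"
    using mult_right_mono[OF cinner_Cauchy_Schwarz[of y z], of "norm x"]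
    by (simp add: norm_scaleC mult_ac)
qed (simp_all add: cinner_add_right scaleC_add_left scaleR_scaleC cinner_scaleC_right scaleC_scaleC)

lemma rank_one_apply [simp]: "blinfun_apply (rank_one x y) z = cinner y z *\<^sub>C x"
  by transfer simp

lemma rank_one_bounded [intro, simp]: "rank_one x y \<in> bounded_ops"
  by (rule bounded_opsI) (simp add: cinner_scaleC_right scaleC_scaleC)

lemma rank_one_add_left: "rank_one (x + x') y = rank_one x y + rank_one x' y"
  by (rule blinfun_eqI) (simp add: blinfun.add_left scaleC_add_right)

lemma rank_one_add_right: "rank_one x (y + y') = rank_one x y + rank_one x y'"
  by (rule blinfun_eqI) (simp add: blinfun.add_left cinner_add_left scaleC_add_left)

lemma rank_one_scale_left: "rank_one (c *\<^sub>C x) y = scale_op c (rank_one x y)"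
  by (rule blinfun_eqI) (simp add: scaleC_scaleC mult.commute)

lemma rank_one_scale_right: "rank_one x (c *\<^sub>C y) = scale_op (cnj c) (rank_one x y)"
  by (rule blinfun_eqI) (simp add: scaleC_scaleC cinner_scaleC_left)

lemma adj_rank_one: "adj (rank_one x y) = rank_one y x"
proof (rule adj_eqI)
  show "cinner (blinfun_apply (rank_one y x) u) v = cinner u (blinfun_apply (rank_one x y) v)" for u v
    using cinner_commute[of u x] by (simp add: cinner_scaleC_left cinner_scaleC_right mult.commute)
qed simp

lemma cinner_rank_one_self:
  "cinner z (blinfun_apply (rank_one y y) z) = complex_of_real ((cmod (cinner y z))\<^sup>2)"
  using cinner_commute[of z y]
  by (simp add: cinner_scaleC_right complex_norm_square[symmetric] del: of_real_power)

lemma positive_rank_one: "positive_op (rank_one y y)"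
  unfolding positive_op_iff cinner_rank_one_self by simp

lemma trace_rank_one: "trace_op (rank_one x y) = cinner y x"
  by (rule trace_op_eqI) (simp add: cinner_scaleC_right Parseval_identity)

text \<open>The absolute value of \<open>|x\<rangle>\<langle>y|\<close> is \<open>(\<parallel>x\<parallel> / \<parallel>y\<parallel>) |y\<rangle>\<langle>y|\<close>; division by zero yields the correct
  value \<open>0\<close> for \<open>y = 0\<close>.\<close>

lemma rank_one_trace_class [intro, simp]: "rank_one x y \<in> trace_class"
proof -
  define c where "c = norm x / norm y"
  define P where "P = c *\<^sub>R rank_one y y"
  have P_form: "cinner z (blinfun_apply P z) = complex_of_real (c * (cmod (cinner y z))\<^sup>2)" for z
    using cinner_rank_one_self[of z y]
    by (simp add: P_def blinfun.scaleR_left bounded_bilinear.scaleR_right[OF bounded_bilinear_cinner]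
        scaleR_conv_of_real del: rank_one_apply)
  have P: "positive_op P"
    unfolding positive_op_iff P_form by (simp add: P_def c_def)
  have "P o\<^sub>L P = adj (rank_one x y) o\<^sub>L rank_one x y"
  proof (rule blinfun_eqI)
    fix z
    show "blinfun_apply (P o\<^sub>L P) z = blinfun_apply (adj (rank_one x y) o\<^sub>L rank_one x y) z"
      by (cases "y = 0") (simp_all add: P_def adj_rank_one blinfun.scaleR_left scaleR_scaleC scaleC_scaleC
          cinner_scaleC_right cinner_self c_def power2_eq_square field_simps)
  qed
  then have abs: "abs_op (rank_one x y) = P"
    by (rule abs_op_eqI[OF P])
  have "((\<lambda>e. (cmod (cinner e y))\<^sup>2) has_sum (norm y)\<^sup>2) trace_basis"
    by (rule Parseval_norm) simp
  moreover have "cmod (cinner e y) = cmod (cinner y e)" for e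
    by (subst cinner_commute) (rule complex_mod_cnj)
  ultimately have "((\<lambda>e. (cmod (cinner y e))\<^sup>2) has_sum (norm y)\<^sup>2) trace_basis"
    by simp
  from has_sum_of_real[OF has_sum_cmult_right[OF this, of c], where ?'a = complex]
  have "(\<lambda>e. cinner e (blinfun_apply P e)) summable_on trace_basis"
    unfolding P_form by (rule has_sum_imp_summable)
  then show ?thesis
    unfolding trace_class_def mem_Collect_eq abs
    by (intro conjI exI[of _ trace_basis]) simp_all
qed

lemma rank_one_compose: "rank_one x y o\<^sub>L A = rank_one x (blinfun_apply (adj A) y)" if "A \<in> bounded_ops"
  by (rule blinfun_eqI) (simp add: cinner_adj_left[OF that])

lemma blinfun_eq_iff_cinner:
  "S = T \<longleftrightarrow> (\<forall>u v. cinner u (blinfun_apply S v) = cinner u (blinfun_apply (T :: 'a::chilbert \<Rightarrow>\<^sub>L 'a) v))"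
  using blinfun_eqI[OF cinner_eqI, of S T] by blast

lemma star_subalgebraD:
  assumes "star_subalgebra M"
  shows "A \<in> M \<Longrightarrow> A \<in> bounded_ops"
    and "A \<in> M \<Longrightarrow> B \<in> M \<Longrightarrow> A + B \<in> M"
    and "A \<in> M \<Longrightarrow> B \<in> M \<Longrightarrow> A o\<^sub>L B \<in> M"
    and "A \<in> M \<Longrightarrow> adj A \<in> M"
    and "A \<in> M \<Longrightarrow> scale_op c A \<in> M"
    and "0 \<in> M"
  using assms unfolding star_subalgebra_def by blast+

section \<open>Quantum operations on rank-one operators\<close>

lemma scale_op_zero [simp]: "scale_op c 0 = 0" and scale_op_zero_left [simp]: "scale_op 0 A = 0"
  by (rule blinfun_eqI, simp)+

lemma trace_class_bounded [intro, simp]: "T \<in> trace_class \<Longrightarrow> T \<in> bounded_ops"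
  by (simp add: trace_class_def)

lemma positive_trace_class_mono:
  assumes P: "positive_op P" "P \<in> trace_class" and Q: "positive_op Q"
    and le: "\<And>x. Re (cinner x (blinfun_apply Q x)) \<le> Re (cinner x (blinfun_apply P x))"
  shows "Q \<in> trace_class"
proof (rule positive_trace_classI[OF Q])
  have "(\<lambda>e. cinner e (blinfun_apply P e)) summable_on trace_basis"
    using traceable_has_sum[OF traceable_positive[OF P] id_in_bounded_ops id_in_bounded_ops]
    by (auto intro: has_sum_imp_summable)
  then have "(\<lambda>e. Re (cinner e (blinfun_apply P e))) summable_on trace_basis"
    by (rule summable_on_Re)
  then show "(\<lambda>e. Re (cinner e (blinfun_apply Q e))) summable_on trace_basis"
  proof (rule summable_on_comparison_test)
    show "Re (cinner e (blinfun_apply Q e)) \<le> Re (cinner e (blinfun_apply P e))" for e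
      by (rule le)
    show "0 \<le> Re (cinner e (blinfun_apply Q e))" for e
      using Q unfolding positive_op_iff by blast
  qed
qed

lemma positive_matrixD:
  "positive_matrix n T \<Longrightarrow> (\<Sum>i<n. cinner (x i) (\<Sum>j<n. blinfun_apply (T i j) (x j))) \<in> \<real>\<^sub>\<ge>\<^sub>0"
  by (simp add: positive_matrix_def)

context
  fixes \<Psi> :: "('a::chilbert \<Rightarrow>\<^sub>L 'a) \<Rightarrow> ('a \<Rightarrow>\<^sub>L 'a)"
  assumes quantum: "quantum_operation \<Psi>"
begin

text \<open>The operator \<open>|x\<rangle>\<langle>y|\<close> is linear in \<open>x\<close> and conjugate-linear in \<open>y\<close>, so that \<open>W\<close> is an operator-valued
  sesquilinear form, to which polarization and Cauchy--Schwarz arguments apply.\<close>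

abbreviation W :: "'a \<Rightarrow> 'a \<Rightarrow> ('a \<Rightarrow>\<^sub>L 'a)" where
  "W x y \<equiv> \<Psi> (rank_one x y)"

lemma quantum_trace_class: "T \<in> trace_class \<Longrightarrow> \<Psi> T \<in> trace_class"
  and quantum_add: "S \<in> trace_class \<Longrightarrow> T \<in> trace_class \<Longrightarrow> \<Psi> (S + T) = \<Psi> S + \<Psi> T"
  and quantum_scale: "T \<in> trace_class \<Longrightarrow> \<Psi> (scale_op c T) = scale_op c (\<Psi> T)"
  and quantum_trace: "T \<in> trace_class \<Longrightarrow> trace_op (\<Psi> T) = trace_op T"
  using quantum unfolding quantum_operation_def by blast+

lemma quantum_cp:
  assumes "\<And>i j. T i j \<in> trace_class" "positive_matrix n T"
  shows "positive_matrix n (\<lambda>i j. \<Psi> (T i j))"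
proof -
  have "completely_positive \<Psi>"
    using quantum unfolding quantum_operation_def by blast
  then show ?thesis
    using assms unfolding completely_positive_def by simp
qed

lemma W_bounded [intro, simp]: "W x y \<in> bounded_ops"
  by (intro trace_class_bounded quantum_trace_class) simp

lemma W_add_left: "W (x + x') y = W x y + W x' y"
  by (simp add: rank_one_add_left quantum_add)

lemma W_add_right: "W x (y + y') = W x y + W x y'"
  by (simp add: rank_one_add_right quantum_add)

lemma W_scale_left: "W (c *\<^sub>C x) y = scale_op c (W x y)"
  by (simp add: rank_one_scale_left quantum_scale)

lemma W_scale_right: "W x (c *\<^sub>C y) = scale_op (cnj c) (W x y)"
  by (simp add: rank_one_scale_right quantum_scale)

lemma trace_W: "trace_op (W x y) = cinner y x"
  by (simp add: quantum_trace trace_rank_one)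

lemma quantum_positive:
  assumes "positive_op P" "P \<in> trace_class"
  shows "positive_op (\<Psi> P)"
proof -
  have "positive_matrix 1 (\<lambda>i j. P)"
    using assms by (simp add: positive_matrix_def positive_op_def)
  then have "positive_matrix 1 (\<lambda>i j. \<Psi> P)"
    by (rule quantum_cp[rotated]) (rule assms)
  from positive_matrixD[OF this, of "\<lambda>_. x" for x]
  have "(\<Sum>i<1::nat. cinner x (\<Sum>j<1::nat. blinfun_apply (\<Psi> P) x)) \<in> \<real>\<^sub>\<ge>\<^sub>0" for x .
  then show ?thesis
    using trace_class_bounded[OF quantum_trace_class[OF assms(2)]] by (simp add: positive_op_def)
qed

lemma W_completely_positive:
  fixes x u :: "nat \<Rightarrow> 'a"
  shows "(\<Sum>i<n. \<Sum>j<n. cinner (u i) (blinfun_apply (W (x i) (x j)) (u j))) \<in> \<real>\<^sub>\<ge>\<^sub>0"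
proof -
  have "positive_matrix n (\<lambda>i j. rank_one (x i) (x j))"
    unfolding positive_matrix_def
  proof (intro conjI allI impI)
    fix z :: "nat \<Rightarrow> 'a"
    define s where "s = (\<Sum>j<n. cinner (x j) (z j))"
    have "(\<Sum>i<n. cinner (z i) (\<Sum>j<n. blinfun_apply (rank_one (x i) (x j)) (z j)))
        = (\<Sum>i<n. \<Sum>j<n. cnj (cinner (x i) (z i)) * cinner (x j) (z j))"
      by (simp add: cinner_sum_right cinner_scaleC_right mult.commute flip: cinner_commute)
    also have "\<dots> = cnj s * s"
      by (simp add: s_def sum_product)
    finally show "(\<Sum>i<n. cinner (z i) (\<Sum>j<n. blinfun_apply (rank_one (x i) (x j)) (z j))) \<in> \<real>\<^sub>\<ge>\<^sub>0"
      unfolding cnj_mult_self by simp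
  qed simp
  then have "positive_matrix n (\<lambda>i j. W (x i) (x j))"
    by (rule quantum_cp[rotated]) simp
  then have "(\<Sum>i<n. cinner (u i) (\<Sum>j<n. blinfun_apply (W (x i) (x j)) (u j))) \<in> \<real>\<^sub>\<ge>\<^sub>0"
    by (rule positive_matrixD)
  then show ?thesis
    by (simp only: cinner_sum_right)
qed

lemma positive_W: "positive_op (W x x)"
  by (intro quantum_positive positive_rank_one) simp

text \<open>Complete positivity at \<open>(x, u)\<close> and \<open>(y, c v)\<close>. As a form in \<open>c\<close> it is the source of both the
  symmetry of \<open>W\<close> and its Cauchy--Schwarz inequality.\<close>

lemma W_two_vectors:
  "cinner u (blinfun_apply (W x x) u) + c * cinner u (blinfun_apply (W x y) v)
    + cnj c * cinner v (blinfun_apply (W y x) u) + cnj c * c * cinner v (blinfun_apply (W y y) v) \<in> \<real>\<^sub>\<ge>\<^sub>0"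
  (is "?form \<in> _")
proof -
  define xs us where "xs i = (if i = 0 then x else y)" and "us i = (if i = 0 then u else c *\<^sub>C v)"
    for i :: nat
  have eq: "(\<Sum>i<2. \<Sum>j<2. cinner (us i) (blinfun_apply (W (xs i) (xs j)) (us j))) = ?form"
    by (simp add: numeral_2_eq_2 xs_def us_def cinner_scaleC_left cinner_scaleC_right
        bounded_opsD[OF W_bounded])
  show ?thesis
    unfolding eq[symmetric] by (rule W_completely_positive)
qed

lemma W_hermitian: "cinner v (blinfun_apply (W y x) u) = cnj (cinner u (blinfun_apply (W x y) v))"
proof -
  define p q where "p = cinner u (blinfun_apply (W x y) v)" and "q = cinner v (blinfun_apply (W y x) u)"
  have diag: "Im (cinner z (blinfun_apply (W x x) z)) = 0" for x z
    using positive_W[of x] by (simp add: positive_op_iff)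
  have "Im p + Im q = 0"
    using W_two_vectors[of u x 1 y v] diag by (simp add: complex_nonneg_Reals_iff p_def q_def)
  moreover have "Re p - Re q = 0"
    using W_two_vectors[of u x \<i> y v] diag by (simp add: complex_nonneg_Reals_iff p_def q_def)
  ultimately show ?thesis
    unfolding p_def[symmetric] q_def[symmetric] by (simp add: complex_eq_iff)
qed

lemma adj_W: "adj (W x y) = W y x"
proof (rule adj_eqI)
  show "cinner (blinfun_apply (W y x) u) v = cinner u (blinfun_apply (W x y) v)" for u v
    using W_hermitian[of v y x u] cinner_commute[of "blinfun_apply (W y x) u" v] by simp
qed (rule W_bounded)

lemma W_Cauchy_Schwarz:
  "(cmod (cinner u (blinfun_apply (W x y) v)))\<^sup>2
    \<le> Re (cinner u (blinfun_apply (W x x) u)) * Re (cinner v (blinfun_apply (W y y) v))"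
proof (rule quadratic_form_discriminant)
  fix c
  let ?b = "cinner u (blinfun_apply (W x y) v)" and ?d = "cinner v (blinfun_apply (W y y) v)"
  have "Re (cnj c * cinner v (blinfun_apply (W y x) u)) = Re (c * ?b)"
    unfolding W_hermitian[of v y x u] complex_cnj_mult[symmetric] by (rule cnj.sel(1))
  moreover have "Re (cnj c * c * ?d) = (cmod c)\<^sup>2 * Re ?d"
    unfolding cnj_mult_self by simp
  ultimately show "0 \<le> Re (cinner u (blinfun_apply (W x x) u)) + 2 * Re (c * ?b) + (cmod c)\<^sup>2 * Re ?d"
    using W_two_vectors[of u x c y v] unfolding complex_nonneg_Reals_iff plus_complex.sel by linarith
qed (use positive_W[of y] in \<open>simp add: positive_op_iff\<close>)

text \<open>A null vector of a positive semidefinite form is orthogonal to everything. Here the form is the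
  one given by complete positivity, and the null vector has the two components \<open>(x, u)\<close> and
  \<open>(x', u')\<close>.\<close>

lemma W_null_vector:
  assumes null: "cinner u (blinfun_apply (W x x) u) + cinner u (blinfun_apply (W x x') u')
    + cinner u' (blinfun_apply (W x' x) u) + cinner u' (blinfun_apply (W x' x') u') = 0"
  shows "cinner u (blinfun_apply (W x y) v) + cinner u' (blinfun_apply (W x' y) v) = 0"
proof -
  define b where "b = cinner u (blinfun_apply (W x y) v) + cinner u' (blinfun_apply (W x' y) v)"
  define d where "d = cinner v (blinfun_apply (W y y) v)"
  have "(cmod b)\<^sup>2 \<le> 0 * Re d"
  proof (rule quadratic_form_discriminant)
    fix c
    define xs us where "xs i = (if i = 0 then x else if i = 1 then x' else y)"
      and "us i = (if i = 0 then u else if i = 1 then u' else c *\<^sub>C v)" for i :: nat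
    have eq: "(\<Sum>i<3. \<Sum>j<3. cinner (us i) (blinfun_apply (W (xs i) (xs j)) (us j)))
        = (cinner u (blinfun_apply (W x x) u) + cinner u (blinfun_apply (W x x') u')
          + cinner u' (blinfun_apply (W x' x) u) + cinner u' (blinfun_apply (W x' x') u'))
        + c * b + cnj c * cnj b + cnj c * c * d"
      by (simp add: numeral_3_eq_3 xs_def us_def cinner_scaleC_left cinner_scaleC_right
          bounded_opsD[OF W_bounded] b_def d_def distrib_left flip: W_hermitian)
    have "c * b + cnj c * cnj b + cnj c * c * d \<in> \<real>\<^sub>\<ge>\<^sub>0"
      using W_completely_positive[where n = 3 and x = xs and u = us] unfolding eq null add_0 .
    then have "0 \<le> Re (c * b) + Re (cnj c * cnj b) + Re (cnj c * c * d)"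
      unfolding complex_nonneg_Reals_iff plus_complex.sel by simp
    moreover have "Re (cnj c * cnj b) = Re (c * b)"
      unfolding complex_cnj_mult[symmetric] by (rule cnj.sel(1))
    moreover have "Re (cnj c * c * d) = (cmod c)\<^sup>2 * Re d"
      unfolding cnj_mult_self by simp
    ultimately show "0 \<le> 0 + 2 * Re (c * b) + (cmod c)\<^sup>2 * Re d"
      by linarith
  qed (use positive_W[of y] in \<open>simp add: positive_op_iff d_def\<close>)
  then show ?thesis by (simp add: b_def)
qed

text \<open>Polarization puts \<open>W x y\<close> into the linear span of positive trace class operators and reduces
  statements about it to the case \<open>x = y\<close>.\<close>

lemma W_polarization:
  "W x y = scale_op (1/4) (W (x + 1 *\<^sub>C y) (x + 1 *\<^sub>C y))
    + (scale_op (-1/4) (W (x + (-1) *\<^sub>C y) (x + (-1) *\<^sub>C y))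
    + (scale_op (\<i>/4) (W (x + \<i> *\<^sub>C y) (x + \<i> *\<^sub>C y))
    + scale_op (-\<i>/4) (W (x + (-\<i>) *\<^sub>C y) (x + (-\<i>) *\<^sub>C y))))"
  (is "_ = ?r")
proof (rule blinfun_eqI, rule cinner_eqI)
  fix u z
  show "cinner u (blinfun_apply (W x y) z) = cinner u (blinfun_apply ?r z)"
    by (simp only: W_add_left W_add_right W_scale_left W_scale_right)
      (simp add: blinfun.add_left cinner_add_right cinner_scaleC_right scaleC_add_right scaleC_scaleC
        field_simps del: scaleC_one)
qed

lemma traceable_W: "traceable (W x y)"
  by (subst W_polarization)
    (intro traceable_add traceable_scale_op traceable_positive positive_W quantum_trace_class rank_one_trace_class)

section \<open>Constants are determined by pure states\<close>

lemma constants_pure_state: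
  assumes A: "A \<in> constants \<Psi>"
  shows "trace_op (W x x o\<^sub>L A) = cinner x (blinfun_apply A x)"
proof (cases "x = 0")
  case True
  have "W 0 0 = scale_op 0 (W 0 0)"
    using W_scale_left[of 0 0 0] by simp
  then have "W 0 0 = 0"
    by (metis blinfun_eqI scale_op_apply scaleC_zero_left zero_blinfun.rep_eq)
  then show ?thesis
    using True by (simp add: trace_op_def)
next
  case False
  have bounded: "A \<in> bounded_ops"
    using A by (simp add: constants_def)
  define r where "r = complex_of_real (norm x)"
  define u where "u = inverse r *\<^sub>C x"
  have "r \<noteq> 0" using False by (simp add: r_def)
  then have x: "x = r *\<^sub>C u"
    by (simp add: u_def scaleC_scaleC)
  have "norm u = 1"
    using False by (simp add: u_def norm_scaleC r_def norm_inverse)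
  then have "rank_one u u \<in> states"
    by (simp add: states_def positive_rank_one trace_rank_one cinner_self)
  then have "trace_op (W u u o\<^sub>L A) = trace_op (rank_one u u o\<^sub>L A)"
    using A by (simp add: constants_def)
  also have "\<dots> = cinner u (blinfun_apply A u)"
    by (simp add: rank_one_compose[OF bounded] trace_rank_one cinner_adj_left[OF bounded])
  finally have "trace_op (W u u o\<^sub>L A) = cinner u (blinfun_apply A u)" .
  moreover have "W x x = scale_op (r * cnj r) (W u u)"
    unfolding x W_scale_left W_scale_right
    by (rule blinfun_eqI) (simp add: scaleC_scaleC mult.commute)
  ultimately show ?thesis
    unfolding x
    by (simp add: trace_op_compose_scale[OF traceable_W bounded] bounded_opsD[OF bounded]
        cinner_scaleC_left cinner_scaleC_right)
qed

lemma constants_trace: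
  assumes A: "A \<in> constants \<Psi>"
  shows "trace_op (W x y o\<^sub>L A) = cinner y (blinfun_apply A x)"
proof -
  have bounded: "A \<in> bounded_ops"
    using A by (simp add: constants_def)
  show ?thesis
    by (subst W_polarization)
      (simp add: trace_op_compose_add traceable_add traceable_scale_op traceable_W bounded
        trace_op_compose_scale constants_pure_state[OF A] blinfun.add_right cinner_add_left
        cinner_add_right bounded_opsD cinner_scaleC_left cinner_scaleC_right field_simps del: scaleC_one)
qed

text \<open>Every state \<open>\<rho> = R\<^sup>2\<close> is an increasing limit of the finite sums of the operators
  \<open>|R e\<rangle>\<langle>R e|\<close>, to which the hypothesis applies. The remainder is positive, and \<open>\<Psi>\<close> preserves its trace,
  which tends to \<open>0\<close>; since \<open>|tr (P A)| \<le> \<parallel>A\<parallel> tr P\<close> for positive \<open>P\<close>, so does the error.\<close>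

lemma constantsI:
  assumes bounded: "A \<in> bounded_ops"
    and pure: "\<And>x. trace_op (W x x o\<^sub>L A) = cinner x (blinfun_apply A x)"
  shows "A \<in> constants \<Psi>"
proof -
  have "trace_op (\<Psi> \<rho> o\<^sub>L A) = trace_op (\<rho> o\<^sub>L A)" if "\<rho> \<in> states" for \<rho>
  proof -
    have \<rho>: "positive_op \<rho>" "\<rho> \<in> trace_class"
      using that by (simp_all add: states_def)
    obtain R where R: "positive_op R" "hilbert_schmidt R" and \<rho>_eq: "\<rho> = R o\<^sub>L R"
      using \<rho> by (rule positive_trace_class_cases)
    define part where "part F = (\<Sum>e\<in>F. rank_one (blinfun_apply R e) (blinfun_apply R e))" for F
    have part_form: "cinner x (blinfun_apply (part F) x)
        = complex_of_real (\<Sum>e\<in>F. (cmod (cinner (blinfun_apply R e) x))\<^sup>2)" for F x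
      by (simp add: part_def blinfun.sum_left cinner_sum_right cinner_rank_one_self del: rank_one_apply)
    have part_bounded: "part F \<in> bounded_ops" for F
      unfolding part_def by (induction F rule: infinite_finite_induct) simp_all
    have part_positive: "positive_op (part F)" for F
      unfolding positive_op_iff part_form by (simp add: part_bounded sum_nonneg)
    have part_le: "Re (cinner x (blinfun_apply (part F) x)) \<le> Re (cinner x (blinfun_apply \<rho> x))"
      if F: "finite F" "F \<subseteq> trace_basis" for F x
    proof -
      have "Re (cinner x (blinfun_apply (part F) x)) = (\<Sum>e\<in>F. (cmod (cinner e (blinfun_apply R x)))\<^sup>2)"
        unfolding part_form by (simp add: positive_op_symmetric[OF R(1)])
      also have "\<dots> \<le> (norm (blinfun_apply R x))\<^sup>2"
        by (rule Bessel_inequality[OF _ F])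
          (rule orthonormal_basis_trace_basis[unfolded orthonormal_basis_iff, THEN conjunct1])
      finally show ?thesis
        unfolding \<rho>_eq cinner_positive_sqrt[OF R(1)] by simp
    qed
    have part_trace_class: "part F \<in> trace_class" if "finite F" "F \<subseteq> trace_basis" for F
      by (rule positive_trace_class_mono[OF \<rho> part_positive part_le[OF that]])
    have rest_positive: "positive_op (\<rho> - part F)" if "finite F" "F \<subseteq> trace_basis" for F
      using \<rho>(1) part_positive[of F] part_le[OF that]
      by (simp add: positive_op_iff blinfun.diff_left cinner_diff_right)
    have rest_trace_class: "\<rho> - part F \<in> trace_class" if "finite F" "F \<subseteq> trace_basis" for F
      by (rule positive_trace_class_mono[OF \<rho> rest_positive[OF that]])
        (use part_positive[of F] in \<open>simp add: blinfun.diff_left cinner_diff_right positive_op_iff\<close>)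
    have part_trace: "trace_op (\<Psi> (part F) o\<^sub>L B) = (\<Sum>e\<in>F. cinner (blinfun_apply R e) (blinfun_apply B (blinfun_apply R e)))"
      if B: "B \<in> bounded_ops" "\<And>x. trace_op (W x x o\<^sub>L B) = cinner x (blinfun_apply B x)"
        and "finite F" "F \<subseteq> trace_basis" for F B
      using that(3,4)
    proof (induction F rule: finite_induct)
      case empty
      have "\<Psi> 0 = scale_op 0 (\<Psi> 0)"
        using quantum_scale[of 0 0] part_trace_class[of "{}"] by (simp add: part_def)
      then show ?case by (simp add: part_def trace_op_def)
    next
      case (insert a F)
      have "\<Psi> (part (insert a F)) = W (blinfun_apply R a) (blinfun_apply R a) + \<Psi> (part F)"
        using insert part_trace_class[of F] by (simp add: part_def quantum_add)
      moreover have "traceable (\<Psi> (part F))"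
        using insert by (intro traceable_positive quantum_positive quantum_trace_class part_positive part_trace_class) auto
      ultimately show ?case
        using insert B by (simp add: trace_op_compose_add traceable_W)
    qed
    have error: "cmod (trace_op (\<Psi> \<rho> o\<^sub>L A) - (\<Sum>e\<in>F. cinner (blinfun_apply R e) (blinfun_apply A (blinfun_apply R e))))
        \<le> norm A * (Re (trace_op \<rho>) - (\<Sum>e\<in>F. (norm (blinfun_apply R e))\<^sup>2))"
      if F: "finite F" "F \<subseteq> trace_basis" for F
    proof -
      have split: "\<Psi> \<rho> = \<Psi> (part F) + \<Psi> (\<rho> - part F)"
        using quantum_add[OF part_trace_class[OF F] rest_trace_class[OF F]] by simp
      have traceable: "traceable (\<Psi> (part F))" "traceable (\<Psi> (\<rho> - part F))"
        using F by (auto intro!: traceable_positive quantum_positive quantum_trace_class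
            part_positive part_trace_class rest_positive rest_trace_class)
      have "trace_op (\<Psi> \<rho> o\<^sub>L A) = trace_op (\<Psi> (part F) o\<^sub>L A) + trace_op (\<Psi> (\<rho> - part F) o\<^sub>L A)"
        unfolding split by (rule trace_op_compose_add[OF traceable bounded])
      then have "trace_op (\<Psi> \<rho> o\<^sub>L A) - (\<Sum>e\<in>F. cinner (blinfun_apply R e) (blinfun_apply A (blinfun_apply R e)))
          = trace_op (\<Psi> (\<rho> - part F) o\<^sub>L A)"
        using part_trace[OF bounded pure F] by simp
      moreover have "trace_op \<rho> = trace_op (\<Psi> (part F)) + trace_op (\<Psi> (\<rho> - part F))"
        using trace_op_compose_add[OF traceable id_in_bounded_ops] quantum_trace[OF \<rho>(2)]
        by (simp flip: split)
      then have "Re (trace_op (\<Psi> (\<rho> - part F))) = Re (trace_op \<rho>) - (\<Sum>e\<in>F. (norm (blinfun_apply R e))\<^sup>2)"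
        using part_trace[OF id_in_bounded_ops _ F] by (simp add: trace_W cinner_self)
      ultimately show ?thesis
        using norm_trace_op_positive_le[OF quantum_positive[OF rest_positive[OF F] rest_trace_class[OF F]]
            quantum_trace_class[OF rest_trace_class[OF F]] bounded] by simp
    qed
    have "((\<lambda>F. norm A * (Re (trace_op \<rho>) - (\<Sum>e\<in>F. (norm (blinfun_apply R e))\<^sup>2)))
        \<longlongrightarrow> norm A * (Re (trace_op \<rho>) - Re (trace_op \<rho>))) (finite_subsets_at_top trace_basis)"
      using positive_sqrt_trace_norm[OF R] unfolding has_sum_def \<rho>_eq by (intro tendsto_intros)
    then have small: "((\<lambda>F. norm A * (Re (trace_op \<rho>) - (\<Sum>e\<in>F. (norm (blinfun_apply R e))\<^sup>2)))
        \<longlongrightarrow> 0) (finite_subsets_at_top trace_basis)"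
      by simp
    have "((\<lambda>F. trace_op (\<Psi> \<rho> o\<^sub>L A) - (\<Sum>e\<in>F. cinner (blinfun_apply R e) (blinfun_apply A (blinfun_apply R e))))
        \<longlongrightarrow> 0) (finite_subsets_at_top trace_basis)"
      by (rule Lim_null_comparison[OF _ small])
        (use error in auto)
    from tendsto_diff[OF tendsto_const[of "trace_op (\<Psi> \<rho> o\<^sub>L A)"] this]
    have "((\<lambda>e. cinner (blinfun_apply R e) (blinfun_apply A (blinfun_apply R e)))
        has_sum trace_op (\<Psi> \<rho> o\<^sub>L A)) trace_basis"
      unfolding has_sum_def by simp
    then show ?thesis
      using positive_sqrt_trace[OF R bounded] unfolding \<rho>_eq[symmetric] by (rule has_sum_unique)
  qed
  then show ?thesis
    using bounded by (simp add: constants_def)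
qed

lemma constants_bounded: "A \<in> constants \<Psi> \<Longrightarrow> A \<in> bounded_ops"
  by (simp add: constants_def)

lemma adj_constants:
  assumes A: "A \<in> constants \<Psi>"
  shows "adj A \<in> constants \<Psi>"
proof (rule constantsI)
  have bounded: "A \<in> bounded_ops"
    by (rule constants_bounded[OF A])
  then show "adj A \<in> bounded_ops" by simp
  fix x
  have "((\<lambda>e. cnj (cinner e (blinfun_apply (W x x) (blinfun_apply A e))))
      has_sum cnj (trace_op (W x x o\<^sub>L A))) trace_basis"
    using traceable_has_sum[OF traceable_W bounded id_in_bounded_ops, of x x]
    by (simp only: has_sum_cnj_iff compose_id blinfun_apply_id_blinfun)
  moreover have "cnj (cinner e (blinfun_apply (W x x) (blinfun_apply A e)))
      = cinner e (blinfun_apply (adj A) (blinfun_apply (W x x) e))" for e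
    using cinner_adj_right[OF bounded, of e "blinfun_apply (W x x) e"]
      positive_op_symmetric[OF positive_W, of x "blinfun_apply A e" e]
    by (metis cinner_commute)
  ultimately have "trace_op (adj A o\<^sub>L W x x) = cnj (trace_op (W x x o\<^sub>L A))"
    by (intro trace_op_eqI) simp
  then show "trace_op (W x x o\<^sub>L adj A) = cinner x (blinfun_apply (adj A) x)"
    using constants_pure_state[OF A, of x] bounded
    by (simp add: trace_op_commute[OF traceable_W] cinner_adj_right flip: cinner_commute)
qed

section \<open>Operators that commute with the quantum operation\<close>

text \<open>If \<open>\<Psi> T = \<Sum>\<^sub>i V\<^sub>i T V\<^sub>i\<^sup>*\<close>, this is the commutant of the operators \<open>V\<^sub>i\<close> and \<open>V\<^sub>i\<^sup>*\<close>. The two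
  conditions on rank-one operators express it without a Kraus decomposition.\<close>

definition intertwiners :: "('a \<Rightarrow>\<^sub>L 'a) set" where
  "intertwiners = {A \<in> bounded_ops. \<forall>x y.
     A o\<^sub>L W x y = W (blinfun_apply A x) y \<and> adj A o\<^sub>L W x y = W (blinfun_apply (adj A) x) y}"

lemma intertwinersI:
  assumes "A \<in> bounded_ops"
    and "\<And>x y. A o\<^sub>L W x y = W (blinfun_apply A x) y"
    and "\<And>x y. adj A o\<^sub>L W x y = W (blinfun_apply (adj A) x) y"
  shows "A \<in> intertwiners"
  using assms by (simp add: intertwiners_def)

lemma intertwinersD:
  assumes "A \<in> intertwiners"
  shows "A \<in> bounded_ops"
    and "blinfun_apply A (blinfun_apply (W x y) z) = blinfun_apply (W (blinfun_apply A x) y) z"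
    and "blinfun_apply (adj A) (blinfun_apply (W x y) z) = blinfun_apply (W (blinfun_apply (adj A) x) y) z"
  using assms unfolding intertwiners_def
  by (auto simp flip: blinfun_apply_blinfun_compose)

lemma intertwiners_star_subalgebra: "star_subalgebra intertwiners"
proof -
  have "\<Psi> (rank_one 0 y) = 0" for y
    using W_scale_left[of 0 0 y] by simp
  then have "0 \<in> intertwiners"
    by (intro intertwinersI) (simp_all add: blinfun_eqI)
  moreover have "A + B \<in> intertwiners" if "A \<in> intertwiners" "B \<in> intertwiners" for A B
    using intertwinersD[OF that(1)] intertwinersD[OF that(2)]
    by (intro intertwinersI blinfun_eqI) (simp_all add: adj_add blinfun.add_left W_add_left)
  moreover have "scale_op c A \<in> intertwiners" if "A \<in> intertwiners" for c A
    using intertwinersD[OF that]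
    by (intro intertwinersI blinfun_eqI) (simp_all add: adj_scale_op W_scale_left)
  moreover have "A o\<^sub>L B \<in> intertwiners" if "A \<in> intertwiners" "B \<in> intertwiners" for A B
    using intertwinersD[OF that(1)] intertwinersD[OF that(2)]
    by (intro intertwinersI blinfun_eqI) (simp_all add: adj_compose)
  moreover have "adj A \<in> intertwiners" if "A \<in> intertwiners" for A
    using intertwinersD[OF that]
    by (intro intertwinersI blinfun_eqI) simp_all
  moreover have "intertwiners \<subseteq> bounded_ops"
    by (auto dest: intertwinersD)
  ultimately show ?thesis
    unfolding star_subalgebra_def by (intro conjI ballI allI) simp_all
qed

lemma id_intertwiner: "id_blinfun \<in> intertwiners"
  by (rule intertwinersI) simp_all

text \<open>Taking adjoints in \<open>A\<^sup>* (W x x) = W (A\<^sup>* x) x\<close> gives \<open>(W x x) A = W x (A\<^sup>* x)\<close>, whose trace is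
  \<open>\<langle>A\<^sup>* x, x\<rangle>\<close>.\<close>

lemma intertwiners_constants: "intertwiners \<subseteq> constants \<Psi>"
proof
  fix A assume A: "A \<in> intertwiners"
  note bounded = intertwinersD(1)[OF A]
  show "A \<in> constants \<Psi>"
  proof (rule constantsI[OF bounded])
    fix x
    have "adj A o\<^sub>L W x x = W (blinfun_apply (adj A) x) x"
      by (rule blinfun_eqI) (simp add: intertwinersD[OF A])
    then have "adj (adj A o\<^sub>L W x x) = W x (blinfun_apply (adj A) x)"
      by (simp only: adj_W)
    then have "W x x o\<^sub>L A = W x (blinfun_apply (adj A) x)"
      using bounded by (simp add: adj_compose adj_W)
    then show "trace_op (W x x o\<^sub>L A) = cinner x (blinfun_apply A x)"
      by (simp add: trace_W cinner_adj_left[OF bounded])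
  qed
qed

text \<open>In the Stinespring picture the vector \<open>A \<otimes> x - 1 \<otimes> A x\<close> has squared norm
  \<open>tr (\<Psi>(|x\<rangle>\<langle>x|) A\<^sup>*A) - tr (\<Psi>(|x\<rangle>\<langle>Ax|) A) - tr (\<Psi>(|Ax\<rangle>\<langle>x|) A\<^sup>*) + tr (\<Psi>(|Ax\<rangle>\<langle>Ax|))\<close>, which vanishes if
  \<open>A\<close> and \<open>A\<^sup>*A\<close> are constants. Evaluated in an orthonormal basis the traces give a sum of
  nonnegative terms, the complete positivity forms at \<open>(x, A\<^sup>* e)\<close> and \<open>(A x, - e)\<close>. Thus all of these
  are null vectors.\<close>

lemma constants_intertwine:
  assumes A: "A \<in> constants \<Psi>" and AA: "adj A o\<^sub>L A \<in> constants \<Psi>"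
  shows "A o\<^sub>L W x y = W (blinfun_apply A x) y"
proof -
  note bounded = constants_bounded[OF A]
  define x' where "x' = blinfun_apply A x"
  define u where "u e = blinfun_apply (adj A) e" for e
  define h where "h e = cinner (u e) (blinfun_apply (W x x) (u e)) + cinner (u e) (blinfun_apply (W x x') (- e))
    + cinner (- e) (blinfun_apply (W x' x) (u e)) + cinner (- e) (blinfun_apply (W x' x') (- e))" for e
  have "((\<lambda>e. cinner e (blinfun_apply A (blinfun_apply (W x x) (blinfun_apply (adj A) e))))
      has_sum cinner x' x') trace_basis"
    using traceable_has_sum[OF traceable_W adj_bounded_ops[OF bounded] bounded, of x x]
    by (simp add: constants_trace[OF AA] cinner_adj_right[OF bounded] x'_def)
  moreover have "((\<lambda>e. cinner e (blinfun_apply A (blinfun_apply (W x x') e))) has_sum cinner x' x') trace_basis"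
    using traceable_has_sum[OF traceable_W id_in_bounded_ops bounded, of x x']
    by (simp add: constants_trace[OF A] x'_def)
  moreover have "((\<lambda>e. cinner e (blinfun_apply (W x' x) (blinfun_apply (adj A) e))) has_sum cinner x' x') trace_basis"
    using traceable_has_sum[OF traceable_W adj_bounded_ops[OF bounded] id_in_bounded_ops, of x' x]
    by (simp add: constants_trace[OF adj_constants[OF A]] cinner_adj_right[OF bounded] x'_def)
  moreover have "((\<lambda>e. cinner e (blinfun_apply (W x' x') e)) has_sum cinner x' x') trace_basis"
    using traceable_has_sum[OF traceable_W id_in_bounded_ops id_in_bounded_ops, of x' x']
    by (simp add: trace_W)
  ultimately have "((\<lambda>e. cinner e (blinfun_apply A (blinfun_apply (W x x) (blinfun_apply (adj A) e)))
      - cinner e (blinfun_apply A (blinfun_apply (W x x') e))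
      - cinner e (blinfun_apply (W x' x) (blinfun_apply (adj A) e))
      + cinner e (blinfun_apply (W x' x') e)) has_sum
      (cinner x' x' - cinner x' x' - cinner x' x' + cinner x' x')) trace_basis"
    by (intro has_sum_add has_sum_diff)
  then have sum: "(h has_sum 0) trace_basis"
    unfolding h_def u_def by (simp add: cinner_adj_left[OF bounded] blinfun.minus_right)
  have "h e = cinner (u e) (blinfun_apply (W x x) (u e)) + 1 * cinner (u e) (blinfun_apply (W x x') (- e))
    + cnj 1 * cinner (- e) (blinfun_apply (W x' x) (u e)) + cnj 1 * 1 * cinner (- e) (blinfun_apply (W x' x') (- e))" for e
    by (simp add: h_def)
  then have h_nonneg: "h e \<in> \<real>\<^sub>\<ge>\<^sub>0" for e
    using W_two_vectors[of "u e" x 1 x' "- e"] by (simp only:)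
  have zero: "h e = 0" if "e \<in> trace_basis" for e
  proof -
    have "Re (h e) = 0"
    proof (rule nonneg_has_sum_le_0D[where f = "\<lambda>e. Re (h e)" and A = trace_basis and a = 0])
      show "((\<lambda>e. Re (h e)) has_sum 0) trace_basis"
        using has_sum_Re[OF sum] by simp
    qed (use that h_nonneg in \<open>auto simp: complex_nonneg_Reals_iff\<close>)
    then show ?thesis
      using h_nonneg[of e] by (simp add: complex_nonneg_Reals_iff complex_eq_iff)
  qed
  show ?thesis
  proof (rule blinfun_eqI)
    fix v
    define d where "d = blinfun_apply (A o\<^sub>L W x y) v - blinfun_apply (W x' y) v"
    have "cinner e d = 0" if e: "e \<in> trace_basis" for e
    proof -
      have "cinner (u e) (blinfun_apply (W x y) v) + cinner (- e) (blinfun_apply (W x' y) v) = 0"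
        by (rule W_null_vector) (use zero[OF e] in \<open>simp only: h_def\<close>)
      then show ?thesis
        by (simp add: d_def u_def cinner_adj_left[OF bounded] cinner_diff_right)
    qed
    then have "d = 0"
      using orthonormal_basis_trace_basis unfolding orthonormal_basis_iff by blast
    then show "blinfun_apply (A o\<^sub>L W x y) v = blinfun_apply (W (blinfun_apply A x) y) v"
      by (simp add: d_def x'_def)
  qed
qed

lemma constants2_eq_intertwiners: "constants2 \<Psi> = intertwiners"
proof (rule Set.equalityI; rule subsetI)
  fix A assume "A \<in> constants2 \<Psi>"
  then have A: "A \<in> bounded_ops" "A \<in> constants \<Psi>" "adj A o\<^sub>L A \<in> constants \<Psi>" "A o\<^sub>L adj A \<in> constants \<Psi>"
    by (simp_all add: constants2_def)
  then have "adj (adj A) o\<^sub>L adj A \<in> constants \<Psi>"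
    by simp
  then show "A \<in> intertwiners"
    by (intro intertwinersI A(1) constants_intertwine[OF A(2,3)]
        constants_intertwine[OF adj_constants[OF A(2)]])
next
  fix A assume A: "A \<in> intertwiners"
  note star = star_subalgebraD[OF intertwiners_star_subalgebra]
  have "A \<in> intertwiners" "adj A o\<^sub>L A \<in> intertwiners" "A o\<^sub>L adj A \<in> intertwiners"
    using A star by simp_all
  then show "A \<in> constants2 \<Psi>"
    using intertwiners_constants intertwinersD(1)[OF A] by (simp add: constants2_def subset_iff)
qed

section \<open>Weak operator closedness\<close>

text \<open>By complete positivity and trace preservation,
  \<open>|\<langle>u, \<Psi>(|z\<rangle>\<langle>y|) v\<rangle>| \<le> \<parallel>z\<parallel> \<parallel>u\<parallel> \<parallel>y\<parallel> \<parallel>v\<parallel>\<close>, so that the expression is represented by a vector as a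
  functional of \<open>z\<close>. This makes the right-hand side \<open>\<Psi>(|Ax\<rangle>\<langle>y|)\<close> of the intertwining relation weakly
  continuous in \<open>A\<close>.\<close>

lemma W_form_le: "Re (cinner u (blinfun_apply (W z z) u)) \<le> (norm z)\<^sup>2 * (norm u)\<^sup>2"
  using positive_form_le_trace[OF positive_W quantum_trace_class[OF rank_one_trace_class], of u z]
  by (simp add: trace_W cinner_self)

lemma W_representing_vector:
  obtains w where "\<And>z. cinner u (blinfun_apply (W z y) v) = cinner w z"
proof (rule Riesz_representation)
  show "bounded_linear (\<lambda>z. cinner u (blinfun_apply (W z y) v))"
  proof (rule bounded_linear_intro)
    fix z
    have "(cmod (cinner u (blinfun_apply (W z y) v)))\<^sup>2
        \<le> Re (cinner u (blinfun_apply (W z z) u)) * Re (cinner v (blinfun_apply (W y y) v))"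
      by (rule W_Cauchy_Schwarz)
    also have "\<dots> \<le> ((norm z)\<^sup>2 * (norm u)\<^sup>2) * ((norm y)\<^sup>2 * (norm v)\<^sup>2)"
      by (intro mult_mono W_form_le) (use positive_W[of y] in \<open>simp_all add: positive_op_iff\<close>)
    also have "\<dots> = (norm z * (norm u * norm y * norm v))\<^sup>2"
      by (simp add: power_mult_distrib mult_ac)
    finally show "norm (cinner u (blinfun_apply (W z y) v)) \<le> norm z * (norm u * norm y * norm v)"
      by (rule power2_le_imp_le) simp
  qed (simp_all add: W_add_left blinfun.add_left cinner_add_right scaleR_scaleC W_scale_left
      cinner_scaleC_right scaleR_conv_of_real)
qed (simp_all add: W_scale_left cinner_scaleC_right that)

lemma weak_operator_closedI:
  fixes C :: "('a \<times> 'a \<Rightarrow> complex) set"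
  assumes "closed C"
  shows "closedin weak_operator_topology {A \<in> bounded_ops. (\<lambda>(x, y). cinner x (blinfun_apply A y)) \<in> C}"
  unfolding weak_operator_topology_def closedin_def topspace_pullback_topology openin_pullback_topology
proof (intro conjI exI[of _ "- C"])
  show "openin euclidean (- C)"
    using assms by (simp add: open_Compl)
qed auto

lemma intertwiners_closedin: "closedin weak_operator_topology intertwiners"
proof -
  have "\<exists>w. \<forall>z. cinner u (blinfun_apply (W z y) v) = cinner w z" for u y v
    using W_representing_vector[of u y v] by metis
  then obtain w where w: "\<And>u y v z. cinner u (blinfun_apply (W z y) v) = cinner (w u y v) z"
    by metis
  \<comment> \<open>A function \<open>g\<close> stands for the matrix coefficients \<open>g (x, y) = \<langle>x, A y\<rangle>\<close>; the second equation is
    the complex conjugate of the intertwining relation for \<open>A\<^sup>*\<close>.\<close>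
  define C where "C = {g :: 'a \<times> 'a \<Rightarrow> complex. \<forall>x y u v.
    g (u, blinfun_apply (W x y) v) = g (w u y v, x) \<and> g (blinfun_apply (W x y) v, u) = g (x, w u y v)}"
  have "closed C"
    unfolding C_def by (intro closed_Collect_all closed_Collect_conj closed_Collect_eq
        continuous_on_product_coordinates)
  have "intertwiners = {A \<in> bounded_ops. (\<lambda>(x, y). cinner x (blinfun_apply A y)) \<in> C}"
    unfolding intertwiners_def
  proof (rule Collect_cong, rule conj_cong[OF refl])
    fix A :: "'a \<Rightarrow>\<^sub>L 'a" assume A: "A \<in> bounded_ops"
    have "A o\<^sub>L W x y = W (blinfun_apply A x) y \<longleftrightarrow>
        (\<forall>u v. cinner u (blinfun_apply A (blinfun_apply (W x y) v)) = cinner (w u y v) (blinfun_apply A x))" for x y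
      by (simp add: blinfun_eq_iff_cinner w)
    moreover have "adj A o\<^sub>L W x y = W (blinfun_apply (adj A) x) y \<longleftrightarrow>
        (\<forall>u v. cinner (blinfun_apply (W x y) v) (blinfun_apply A u) = cinner x (blinfun_apply A (w u y v)))" for x y
    proof -
      have "cinner u (blinfun_apply (adj A) (blinfun_apply (W x y) v))
          = cnj (cinner (blinfun_apply (W x y) v) (blinfun_apply A u))" for u v
        unfolding cinner_adj_right[OF A] by (rule cinner_commute)
      moreover have "cinner u (blinfun_apply (W (blinfun_apply (adj A) x) y) v)
          = cnj (cinner x (blinfun_apply A (w u y v)))" for u v
        unfolding w[of u "blinfun_apply (adj A) x"] cinner_adj_right[OF A] by (rule cinner_commute)
      ultimately show ?thesis
        by (simp only: blinfun_eq_iff_cinner blinfun_apply_blinfun_compose complex_cnj_cancel_iff)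
    qed
    ultimately show "(\<forall>x y. A o\<^sub>L W x y = W (blinfun_apply A x) y \<and> adj A o\<^sub>L W x y = W (blinfun_apply (adj A) x) y)
        \<longleftrightarrow> (\<lambda>(x, y). cinner x (blinfun_apply A y)) \<in> C"
      unfolding C_def by auto
  qed
  then show ?thesis
    using weak_operator_closedI[OF \<open>closed C\<close>] by simp
qed

lemma intertwiners_von_neumann: "von_neumann_algebra intertwiners"
  unfolding von_neumann_algebra_def
  using intertwiners_star_subalgebra id_intertwiner intertwiners_closedin by blast

end

section \<open>Algebras generated by a constant\<close>

lemma weak_operator_closed_imp_closed:
  assumes "closedin weak_operator_topology (M :: ('a::chilbert \<Rightarrow>\<^sub>L 'a) set)"
  shows "closed M"
proof -
  define f :: "('a \<Rightarrow>\<^sub>L 'a) \<Rightarrow> ('a \<times> 'a \<Rightarrow> complex)" where "f A = (\<lambda>(x, y). cinner x (blinfun_apply A y))" for A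
  obtain U where U: "open U" "bounded_ops - M = f -` U \<inter> bounded_ops" and sub: "M \<subseteq> bounded_ops"
    using assms unfolding weak_operator_topology_def closedin_def topspace_pullback_topology
      openin_pullback_topology f_def by auto
  have "continuous_on UNIV f"
  proof (rule continuous_on_coordinatewise_then_product)
    fix p :: "'a \<times> 'a"
    have "continuous_on UNIV (\<lambda>A. cinner (fst p) (blinfun_apply A (snd p)))"
      by (intro bounded_linear.continuous_on[OF bounded_linear_cinner_right] continuous_intros)
    then show "continuous_on UNIV (\<lambda>A. f A p)"
      by (simp add: f_def case_prod_beta)
  qed
  then have "open (f -` U)"
    using U(1) by (simp add: open_vimage)
  moreover have "M = bounded_ops \<inter> - (f -` U)"
    using U(2) sub by blast
  ultimately show ?thesis
    using closed_bounded_ops by (metis closed_Compl closed_Int)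
qed

lemma von_neumann_imp_cstar: "von_neumann_algebra M \<Longrightarrow> cstar_algebra M"
  by (simp add: von_neumann_algebra_def cstar_algebra_def weak_operator_closed_imp_closed)

lemma eval_poly_in_star_subalgebra:
  assumes M: "star_subalgebra M" and "id_blinfun \<in> M" "A \<in> M" "B \<in> M"
  shows "eval_poly p A B \<in> M"
proof -
  have "eval_word A B w \<in> M" for w
  proof (induction w)
    case (Cons a w)
    then show ?case
      using assms by (cases a) (simp_all add: star_subalgebraD(3)[OF M])
  qed (use assms in simp)
  then have "scale_op (Poly_Mapping.lookup p w) (eval_word A B w) \<in> M" for w
    by (rule star_subalgebraD(5)[OF M])
  then have "(\<Sum>w\<in>F. scale_op (Poly_Mapping.lookup p w) (eval_word A B w)) \<in> M" for F
    by (induction F rule: infinite_finite_induct) (simp_all add: star_subalgebraD(2,6)[OF M])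
  then show ?thesis
    unfolding eval_poly_def .
qed

lemma eval_poly_word: "eval_poly (Poly_Mapping.single w 1) A B = eval_word A B w"
  by (simp add: eval_poly_def) (rule blinfun_eqI, simp)

theorem theorem5p4:
  fixes \<Psi> :: "('a::chilbert \<Rightarrow>\<^sub>L 'a) \<Rightarrow> ('a \<Rightarrow>\<^sub>L 'a)"
  assumes "quantum_operation \<Psi>"
  shows "(constants2 \<Psi> = constants_p \<Psi> \<and> constants_p \<Psi> = constants_c \<Psi> \<and>
          constants_c \<Psi> = constants_w \<Psi> \<and> von_neumann_algebra (constants2 \<Psi>)) \<and>
         (((\<forall>A\<in>constants \<Psi>. \<forall>B\<in>constants \<Psi>. A o\<^sub>L B \<in> constants \<Psi>)
             \<longleftrightarrow> constants \<Psi> = constants2 \<Psi>) \<and>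
          (constants \<Psi> = constants2 \<Psi> \<longleftrightarrow> cstar_algebra (constants \<Psi>)) \<and>
          (cstar_algebra (constants \<Psi>) \<longleftrightarrow> von_neumann_algebra (constants \<Psi>)))"
proof -
  have vn: "von_neumann_algebra (constants2 \<Psi>)"
    using intertwiners_von_neumann[OF assms] constants2_eq_intertwiners[OF assms] by simp
  have sub: "constants2 \<Psi> \<subseteq> constants \<Psi>"
    by (auto simp: constants2_def)
  have "constants2 \<Psi> \<subseteq> constants_w \<Psi>"
  proof
    fix A assume A: "A \<in> constants2 \<Psi>"
    then have "vn_generated {A} \<subseteq> constants2 \<Psi>"
      using vn unfolding vn_generated_def by blast
    then show "A \<in> constants_w \<Psi>"
      using A sub by (auto simp: constants_w_def constants2_def)
  qed
  moreover have "constants_w \<Psi> \<subseteq> constants_c \<Psi>"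
  proof
    fix A assume A: "A \<in> constants_w \<Psi>"
    have "cstar_generated {id_blinfun, A} \<subseteq> vn_generated {A}"
      unfolding cstar_generated_def vn_generated_def
      using von_neumann_imp_cstar by (auto simp: von_neumann_algebra_def)
    then show "A \<in> constants_c \<Psi>"
      using A by (auto simp: constants_w_def constants_c_def)
  qed
  moreover have "constants_c \<Psi> \<subseteq> constants_p \<Psi>"
  proof
    fix A assume A: "A \<in> constants_c \<Psi>"
    have "eval_poly p A (adj A) \<in> cstar_generated {id_blinfun, A}" for p
      unfolding cstar_generated_def
      by (auto simp: cstar_algebra_def intro!: eval_poly_in_star_subalgebra star_subalgebraD(4))
    then show "A \<in> constants_p \<Psi>"
      using A by (auto simp: constants_c_def constants_p_def)
  qed
  moreover have "constants_p \<Psi> \<subseteq> constants2 \<Psi>"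
  proof
    fix A assume A: "A \<in> constants_p \<Psi>"
    then have "eval_word A (adj A) w \<in> constants \<Psi>" for w
      unfolding constants_p_def by (metis (mono_tags, lifting) eval_poly_word mem_Collect_eq)
    from this[of "[VarX]"] this[of "[VarY, VarX]"] this[of "[VarX, VarY]"]
    show "A \<in> constants2 \<Psi>"
      using A by (simp add: constants2_def constants_p_def)
  qed
  ultimately have a: "constants2 \<Psi> = constants_p \<Psi>" "constants_p \<Psi> = constants_c \<Psi>"
      "constants_c \<Psi> = constants_w \<Psi>"
    by blast+
  have i_ii: "constants \<Psi> = constants2 \<Psi>"
    if "\<forall>A\<in>constants \<Psi>. \<forall>B\<in>constants \<Psi>. A o\<^sub>L B \<in> constants \<Psi>"
    using that adj_constants[OF assms] constants_bounded[OF assms] by (auto simp: constants2_def)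
  have ii_iv: "von_neumann_algebra (constants \<Psi>)" if "constants \<Psi> = constants2 \<Psi>"
    using vn that by simp
  have iii_i: "\<forall>A\<in>constants \<Psi>. \<forall>B\<in>constants \<Psi>. A o\<^sub>L B \<in> constants \<Psi>" if "cstar_algebra (constants \<Psi>)"
    using that unfolding cstar_algebra_def star_subalgebra_def by blast
  have iv_iii: "cstar_algebra (constants \<Psi>)" if "von_neumann_algebra (constants \<Psi>)"
    using that by (rule von_neumann_imp_cstar)
  have "(\<forall>A\<in>constants \<Psi>. \<forall>B\<in>constants \<Psi>. A o\<^sub>L B \<in> constants \<Psi>) \<longleftrightarrow> constants \<Psi> = constants2 \<Psi>"
    by (rule iffI, erule i_ii, rule iii_i, rule iv_iii, erule ii_iv)
  moreover have "constants \<Psi> = constants2 \<Psi> \<longleftrightarrow> cstar_algebra (constants \<Psi>)"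
    by (rule iffI, rule iv_iii, erule ii_iv, rule i_ii, erule iii_i)
  moreover have "cstar_algebra (constants \<Psi>) \<longleftrightarrow> von_neumann_algebra (constants \<Psi>)"
    by (rule iffI, rule ii_iv, rule i_ii, erule iii_i, erule iv_iii)
  ultimately show ?thesis
    by (intro conjI a vn)
qed

end
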